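(* Let $\eta>0$ and suppose that for all $\alpha\in\mathcal A$ $$S(\alpha)^\top P(\alpha)+P(\alpha)S(\alpha)\preceq-2\eta P(\alpha).$$ For $\tau>0$ and $\alpha\in\mathcal A$ define $$\kappa(\tau,\alpha)=e^{-\eta\tau}+\tau^2e^{\tau M_{tot}(\alpha)}\sum_{k=2}^m g(\tau M_k(\alpha))\sum_{i=1}^{k-1}K_{ik}(\alpha),\qquad \kappa^*(\tau)=\sup_{\alpha\in\mathcal A}\kappa(\tau,\alpha).$$ Let $\tau>0$ and suppose $\kappa^*(\tau)<1$. Then for every fixed $\alpha\in\mathcal A$ the $\tau$-periodic switched system determined by $\alpha$ is exponentially stable, uniformly over $\mathcal A$. In particular, for every $\alpha\in\mathcal A$ and every solution $x$ of this system, $$\|x(k\tau)\|_{P(\alpha)}\le\kappa^*(\tau)^k\|x(0)\|_{P(\alpha)},\qquad k=0,1,2,\dots,$$ and, if $t=k\tau+s$ with $k\in\{0,1,2,\dots\}$ and $s\in[0,\tau)$, then $$\|x(t)\|_{P(\alpha)}\le e^{s\Gamma^*}\kappa^*(\tau)^k\|x(0)\|_{P(\alpha)},$$ where $\Gamma(\alpha)=\max_{1\le i\le m}\|A_i\|_{P(\alpha)}$ and $\Gamma^*=\sup_{\alpha\in\mathcal A}\Gamma(\alpha)<\infty$.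
   Context: Let $A_1,\dots,A_m$ be real $n\times n$ matrices, let $\Delta^{m-1}=\{\alpha\in\mathbb R^m_{\ge0}:\sum_{i=1}^m\alpha_i=1\}$, let $\mathcal A\subseteq\Delta^{m-1}$ be compact, and let $P$ be a continuous map from $\mathcal A$ to the set of real symmetric positive definite $n\times n$ matrices. For symmetric matrices, $X\preceq Y$ means $Y-X$ is positive semidefinite. For a symmetric positive definite $Q$, $\|x\|_Q=\sqrt{x^\top Qx}$ on $\mathbb R^n$, and $\|M\|_Q=\sup_{x\ne0}\|Mx\|_Q/\|x\|_Q$ is the induced operator norm of a real $n\times n$ matrix $M$. For $\alpha\in\mathcal A$ define $B_i(\alpha)=\alpha_iA_i$, $S(\alpha)=\sum_{i=1}^mB_i(\alpha)$, $M_i(\alpha)=\|B_i(\alpha)\|_{P(\alpha)}$, $M_{tot}(\alpha)=\sum_{i=1}^mM_i(\alpha)$, and, for $1\le i\le k\le m$, $K_{ik}(\alpha)=\|[B_k(\alpha),B_i(\alpha)]\|_{P(\alpha)}$, where $[X,Y]=XY-YX$. The scalar function $g$ is $g(z)=\int_0^1(1-s)e^{2zs}\,ds$, that is, $g(z)=\frac{e^{2z}-1-2z}{4z^2}$ for $z\neq0$ and $g(0)=\frac12$. The $\tau$-periodic switched system determined by $\alpha$ is $\dot x(t)=A_{\sigma(t)}x(t)$, $x(t)\in\mathbb R^n$, $t\ge0$, where $\sigma$ is $\tau$-periodic and over each period $[k\tau,(k+1)\tau)$ the modes are visited in the fixed order $1,\dots,m$, mode $i$ being active for time $\alpha_i\tau$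 (solutions are continuous and piecewise differentiable). Thus $x((k+1)\tau)=e^{\tau B_m(\alpha)}\cdots e^{\tau B_1(\alpha)}x(k\tau)$. Exponential stability uniformly over $\mathcal A$ means that, for the given $\tau$, there are constants $C\ge1$ and $\lambda>0$ independent of $\alpha\in\mathcal A$ such that $\|x(t)\|_{P(\alpha)}\le Ce^{-\lambda t}\|x(0)\|_{P(\alpha)}$ for all $t\ge0$, all $\alpha\in\mathcal A$ and all solutions $x$. *)

theory Defs
  imports "HOL-Analysis.Analysis"
begin

definition spd :: "real^'n^'n \<Rightarrow> bool" where
  "spd Q \<longleftrightarrow> transpose Q = Q \<and> (\<forall>x. x \<noteq> 0 \<longrightarrow> 0 < x \<bullet> (Q *v x))"

definition psd :: "real^'n^'n \<Rightarrow> bool" where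
  "psd Q \<longleftrightarrow> transpose Q = Q \<and> (\<forall>x. 0 \<le> x \<bullet> (Q *v x))"

definition loewner_le :: "real^'n^'n \<Rightarrow> real^'n^'n \<Rightarrow> bool" where
  "loewner_le X Y \<longleftrightarrow> psd (Y - X)"

definition wnorm :: "real^'n^'n \<Rightarrow> real^'n \<Rightarrow> real" where
  "wnorm Q x = sqrt (x \<bullet> (Q *v x))"

definition wopnorm :: "real^'n^'n \<Rightarrow> real^'n^'n \<Rightarrow> real" where
  "wopnorm Q M = (SUP x\<in>{x. x \<noteq> 0}. wnorm Q (M *v x) / wnorm Q x)"

definition commutator :: "real^'n^'n \<Rightarrow> real^'n^'n \<Rightarrow> real^'n^'n" where
  "commutator X Y = X ** Y - Y ** X"

text \<open>
  A vector of \<open>\<real>\<^sup>m\<close> is a function on \<^typ>\<open>nat\<close> that vanishes outside \<open>{1..m}\<close>.  On such functions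
  the product topology, which is the library's topology on \<^typ>\<open>nat \<Rightarrow> real\<close>, is the
  usual topology of \<open>\<real>\<^sup>m\<close>; compactness and continuity below refer to it.
\<close>

definition weight_simplex :: "nat \<Rightarrow> (nat \<Rightarrow> real) set" where
  "weight_simplex m =
     {\<alpha>. (\<forall>i. i \<notin> {1..m} \<longrightarrow> \<alpha> i = 0) \<and> (\<forall>i\<in>{1..m}. 0 \<le> \<alpha> i) \<and> (\<Sum>i=1..m. \<alpha> i) = 1}"

definition scaled_mode :: "(nat \<Rightarrow> real^'n^'n) \<Rightarrow> (nat \<Rightarrow> real) \<Rightarrow> nat \<Rightarrow> real^'n^'n" where
  "scaled_mode A \<alpha> i = \<alpha> i *\<^sub>R A i"

definition mean_matrix :: "nat \<Rightarrow> (nat \<Rightarrow> real^'n^'n) \<Rightarrow> (nat \<Rightarrow> real) \<Rightarrow> real^'n^'n" where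
  "mean_matrix m A \<alpha> = (\<Sum>i=1..m. scaled_mode A \<alpha> i)"

definition mode_norm ::
    "(nat \<Rightarrow> real^'n^'n) \<Rightarrow> ((nat \<Rightarrow> real) \<Rightarrow> real^'n^'n) \<Rightarrow> (nat \<Rightarrow> real) \<Rightarrow> nat \<Rightarrow> real" where
  "mode_norm A P \<alpha> i = wopnorm (P \<alpha>) (scaled_mode A \<alpha> i)"

definition total_norm ::
    "nat \<Rightarrow> (nat \<Rightarrow> real^'n^'n) \<Rightarrow> ((nat \<Rightarrow> real) \<Rightarrow> real^'n^'n) \<Rightarrow> (nat \<Rightarrow> real) \<Rightarrow> real" where
  "total_norm m A P \<alpha> = (\<Sum>i=1..m. mode_norm A P \<alpha> i)"

definition comm_norm ::
    "(nat \<Rightarrow> real^'n^'n) \<Rightarrow> ((nat \<Rightarrow> real) \<Rightarrow> real^'n^'n) \<Rightarrow> (nat \<Rightarrow> real) \<Rightarrow> nat \<Rightarrow> nat \<Rightarrow> real" where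
  "comm_norm A P \<alpha> i k =
     wopnorm (P \<alpha>) (commutator (scaled_mode A \<alpha> k) (scaled_mode A \<alpha> i))"

definition g :: "real \<Rightarrow> real" where
  "g z = integral {0..1} (\<lambda>s. (1 - s) * exp (2 * z * s))"

definition kappa ::
    "nat \<Rightarrow> (nat \<Rightarrow> real^'n^'n) \<Rightarrow> ((nat \<Rightarrow> real) \<Rightarrow> real^'n^'n) \<Rightarrow> real \<Rightarrow> real \<Rightarrow> (nat \<Rightarrow> real) \<Rightarrow> real"
  where
  "kappa m A P \<eta> \<tau> \<alpha> =
     exp (- \<eta> * \<tau>) +
     \<tau>\<^sup>2 * exp (\<tau> * total_norm m A P \<alpha>) *
       (\<Sum>k=2..m. g (\<tau> * mode_norm A P \<alpha> k) * (\<Sum>i=1..k-1. comm_norm A P \<alpha> i k))"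

text \<open>
  The suprema over \<open>\<A>\<close> are taken in the reals.  For compact \<open>\<A>\<close> and continuous positive definite
  \<open>P\<close> the families are bounded, so these are genuine suprema whenever \<open>\<A>\<close> is nonempty.
\<close>

definition kappa_sup ::
    "nat \<Rightarrow> (nat \<Rightarrow> real^'n^'n) \<Rightarrow> ((nat \<Rightarrow> real) \<Rightarrow> real^'n^'n) \<Rightarrow> (nat \<Rightarrow> real) set \<Rightarrow> real \<Rightarrow> real \<Rightarrow> real"
  where
  "kappa_sup m A P \<A> \<eta> \<tau> = (SUP \<alpha>\<in>\<A>. kappa m A P \<eta> \<tau> \<alpha>)"

definition growth ::
    "nat \<Rightarrow> (nat \<Rightarrow> real^'n^'n) \<Rightarrow> ((nat \<Rightarrow> real) \<Rightarrow> real^'n^'n) \<Rightarrow> (nat \<Rightarrow> real) \<Rightarrow> real" where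
  "growth m A P \<alpha> = Max ((\<lambda>i. wopnorm (P \<alpha>) (A i)) ` {1..m})"

definition growth_sup ::
    "nat \<Rightarrow> (nat \<Rightarrow> real^'n^'n) \<Rightarrow> ((nat \<Rightarrow> real) \<Rightarrow> real^'n^'n) \<Rightarrow> (nat \<Rightarrow> real) set \<Rightarrow> real" where
  "growth_sup m A P \<A> = (SUP \<alpha>\<in>\<A>. growth m A P \<alpha>)"

text \<open>
  For \<open>\<alpha> \<in> weight_simplex m\<close>, \<open>\<tau> > 0\<close> and \<open>t \<ge> 0\<close> exactly one mode satisfies the description:
  the half-open intervals tile \<open>[0, \<infinity>)\<close>, those of modes with \<open>\<alpha> i = 0\<close> being empty.
\<close>

definition switching_signal :: "nat \<Rightarrow> (nat \<Rightarrow> real) \<Rightarrow> real \<Rightarrow> real \<Rightarrow> nat" where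
  "switching_signal m \<alpha> \<tau> t =
     (THE i. i \<in> {1..m} \<and>
       (\<exists>k::nat. t \<in> {real k * \<tau> + \<tau> * (\<Sum>j=1..<i. \<alpha> j) ..< real k * \<tau> + \<tau> * (\<Sum>j=1..i. \<alpha> j)}))"

text \<open>
  A solution is continuous on \<open>[0, \<infinity>)\<close> and satisfies the differential equation outside a set
  of times that is finite in every bounded interval (such as the switching times, where the
  derivative need not exist).  Its values at negative times are irrelevant.
\<close>

definition switched_solution ::
    "nat \<Rightarrow> (nat \<Rightarrow> real^'n^'n) \<Rightarrow> (nat \<Rightarrow> real) \<Rightarrow> real \<Rightarrow> (real \<Rightarrow> real^'n) \<Rightarrow> bool" where
  "switched_solution m A \<alpha> \<tau> x \<longleftrightarrow>
     continuous_on {0..} x \<and>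
     (\<forall>T\<ge>0. \<exists>F. finite F \<and>
        (\<forall>t\<in>{0..T} - F.
           (x has_vector_derivative A (switching_signal m \<alpha> \<tau> t) *v x t) (at t within {0..})))"

definition uniformly_exp_stable ::
    "nat \<Rightarrow> (nat \<Rightarrow> real^'n^'n) \<Rightarrow> ((nat \<Rightarrow> real) \<Rightarrow> real^'n^'n) \<Rightarrow> (nat \<Rightarrow> real) set \<Rightarrow> real \<Rightarrow> bool"
  where
  "uniformly_exp_stable m A P \<A> \<tau> \<longleftrightarrow>
     (\<exists>C\<ge>1. \<exists>r>0. \<forall>\<alpha>\<in>\<A>. \<forall>x. switched_solution m A \<alpha> \<tau> x \<longrightarrow>
        (\<forall>t\<ge>0. wnorm (P \<alpha>) (x t) \<le> C * exp (- r * t) * wnorm (P \<alpha>) (x 0)))"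

end

theory Submission
  imports Defs
begin

text \<open>
  Over one period the state is multiplied by \<open>e\<^bsup>\<tau>B\<^sub>m\<^esup> \<cdots> e\<^bsup>\<tau>B\<^sub>1\<^esup>\<close>, which is compared with the averaged
  flow \<open>e\<^bsup>\<tau>S\<^esup>\<close>.  The Lyapunov inequality makes the latter a contraction by \<open>e\<^bsup>-\<eta>\<tau>\<^esup>\<close> in the norm of
  \<open>P(\<alpha>)\<close>.  With \<open>S\<^sub>k = B\<^sub>1 + \<cdots> + B\<^sub>k\<close>, the difference of the two telescopes over \<open>k\<close> into terms
  \<open>e\<^bsup>\<tau>B\<^sub>k\<^esup> e\<^bsup>\<tau>S\<^sub>k\<^sub>-\<^sub>1\<^esup> - e\<^bsup>\<tau>S\<^sub>k\<^esup>\<close>.  Two applications of Duhamel's formula bound such a term by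
  \<open>\<tau>\<^sup>2/2 \<cdot> e\<^bsup>\<tau>(M\<^sub>1 + \<cdots> + M\<^sub>k)\<^esup> (K\<^sub>1\<^sub>k + \<cdots> + K\<^sub>k\<^sub>-\<^sub>1\<^sub>,\<^sub>k)\<close>, and \<open>1/2 = g 0 \<le> g z\<close> for \<open>z \<ge> 0\<close>.
\<close>

section \<open>The matrix exponential\<close>

lemma bounded_bilinear_matrix_vector_mult:
  "bounded_bilinear ((*v) :: real^'n^'m \<Rightarrow> real^'n \<Rightarrow> real^'m)"
  unfolding bilinear_conv_bounded_bilinear[symmetric] bilinear_def
  by (auto intro!: linearI simp: algebra_simps scaleR_matrix_vector_assoc)

lemmas has_vector_derivative_matrix_vector =
  bounded_bilinear.has_vector_derivative[OF bounded_bilinear_matrix_vector_mult]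

text \<open>The entries have a general Euclidean type, so two applications descend from a matrix to
  its rows and then to real entries, where power series are differentiated termwise.\<close>

lemma has_vector_derivative_vecI:
  fixes f :: "real \<Rightarrow> 'a::euclidean_space^'n"
  assumes "\<And>i. ((\<lambda>t. f t $ i) has_vector_derivative f' $ i) (at t)"
  shows "(f has_vector_derivative f') (at t)"
  unfolding has_vector_derivative_def has_derivative_componentwise_within[of f]
proof
  fix b :: "'a^'n" assume "b \<in> Basis"
  then obtain i u where "b = axis i u" by (auto simp: Basis_vec_def)
  moreover have "((\<lambda>t. f t $ i \<bullet> u) has_derivative (\<lambda>x. (x *\<^sub>R f' $ i) \<bullet> u)) (at t)"
    using assms[of i] unfolding has_vector_derivative_def by (rule has_derivative_inner_left)
  ultimately show "((\<lambda>t. f t \<bullet> b) has_derivative (\<lambda>x. (x *\<^sub>R f') \<bullet> b)) (at t)"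
    by (simp add: inner_axis)
qed

fun matpow :: "real^'n^'n \<Rightarrow> nat \<Rightarrow> real^'n^'n" where
  "matpow M 0 = mat 1"
| "matpow M (Suc n) = M ** matpow M n"

lemma matpow_Suc_right: "matpow M (Suc n) = matpow M n ** M"
  by (induction n) (simp_all add: matrix_mul_assoc)

lemma matpow_scaleR: "matpow (c *\<^sub>R M) n = c ^ n *\<^sub>R matpow M n"
  by (induction n) (simp_all add: matrix_scalar_ac scalar_matrix_assoc[symmetric])

lemma matpow_entry_bound: "\<exists>K\<ge>0. \<forall>n i j. \<bar>matpow M n $ i $ j\<bar> \<le> K ^ n"
  for M :: "real^'n^'n"
proof -
  define b where "b = norm M"
  have b: "\<bar>M $ i $ j\<bar> \<le> b" for i j
    unfolding b_def by (metis Finite_Cartesian_Product.norm_nth_le order_trans real_norm_def)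
  \<comment> \<open>An entry of a product is a sum of \<open>CARD('n)\<close> terms, so each
    multiplication by \<open>M\<close> costs this factor.\<close>
  let ?K = "real CARD('n) * b"
  have "\<bar>matpow M n $ i $ j\<bar> \<le> ?K ^ n" for n i j
  proof (induction n arbitrary: i j)
    case 0
    show ?case by (simp add: mat_def)
  next
    case (Suc n)
    have "\<bar>matpow M (Suc n) $ i $ j\<bar> \<le> (\<Sum>k\<in>UNIV. \<bar>M $ i $ k * matpow M n $ k $ j\<bar>)"
      by (simp add: matrix_matrix_mult_def)
    also have "\<dots> \<le> (\<Sum>k\<in>(UNIV::'n set). b * ?K ^ n)"
      unfolding abs_mult by (intro sum_mono mult_mono b Suc) (auto simp: b_def)
    finally show ?case by simp
  qed
  moreover have "?K \<ge> 0" by (simp add: b_def)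
  ultimately show ?thesis by blast
qed

text \<open>\<open>flow M t\<close> is \<open>e\<^bsup>tM\<^esup>\<close>.  The library's \<^const>\<open>exp\<close> is not available on matrices, whose type is not a
  Banach algebra, so the series is taken entrywise.\<close>

definition flow :: "real^'n^'n \<Rightarrow> real \<Rightarrow> real^'n^'n" where
  "flow M t = (\<chi> i j. \<Sum>n. matpow M n $ i $ j / fact n * t ^ n)"

lemma summable_flow: "summable (\<lambda>n. matpow M n $ i $ j / fact n * t ^ n)"
proof -
  obtain K where K: "K \<ge> 0" "\<And>n i j. \<bar>matpow M n $ i $ j\<bar> \<le> K ^ n"
    using matpow_entry_bound by blast
  show ?thesis
  proof (rule summable_comparison_test'[OF summable_exp[of "K * \<bar>t\<bar>"]])
    fix n :: nat
    have "\<bar>matpow M n $ i $ j\<bar> * \<bar>t\<bar> ^ n \<le> K ^ n * \<bar>t\<bar> ^ n"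
      by (intro mult_right_mono K) auto
    then show "norm (matpow M n $ i $ j / fact n * t ^ n) \<le> inverse (fact n) * (K * \<bar>t\<bar>) ^ n"
      by (simp add: abs_mult power_abs power_mult_distrib divide_simps)
  qed
qed

lemma flow_0 [simp]: "flow M 0 = mat 1" for M :: "real^'n^'n"
proof -
  have "(\<Sum>n. matpow M n $ i $ j / fact n * 0 ^ n) = (mat 1 :: real^'n^'n) $ i $ j"
    for i j :: 'n
    using powser_zero[of "\<lambda>n. matpow M n $ i $ j / fact n"] by simp
  then show ?thesis by (simp add: flow_def vec_eq_iff)
qed

lemma flow_scaleR: "flow (c *\<^sub>R M) t = flow M (c * t)"
  by (simp add: flow_def matpow_scaleR power_mult_distrib mult_ac)

text \<open>The right-hand side is the termwise derivative of the entry series of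
  \<open>flow M t\<close>. The finite sum over the inner index is exchanged with the convergent
  series.\<close>

lemma matrix_mult_flow_entry:
  "(M ** flow M t) $ i $ j = (\<Sum>n. matpow M (Suc n) $ i $ j / fact n * t ^ n)"
proof -
  have "(\<Sum>n. matpow M (Suc n) $ i $ j / fact n * t ^ n)
      = (\<Sum>n. \<Sum>k\<in>UNIV. M $ i $ k * (matpow M n $ k $ j / fact n * t ^ n))"
    by (simp add: matrix_matrix_mult_def sum_divide_distrib sum_distrib_left mult_ac times_divide_eq_right)
  also have "\<dots> = (\<Sum>k\<in>UNIV. \<Sum>n. M $ i $ k * (matpow M n $ k $ j / fact n * t ^ n))"
    by (intro suminf_sum summable_mult summable_flow)
  also have "\<dots> = (\<Sum>k\<in>UNIV. M $ i $ k * (\<Sum>n. matpow M n $ k $ j / fact n * t ^ n))"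
    by (intro sum.cong refl suminf_mult summable_flow)
  finally show ?thesis by (simp add: matrix_matrix_mult_def flow_def)
qed

text \<open>Splitting the extra factor off on the right leads to the same series as on the left;
  comparing the two shows that \<open>M\<close> commutes with its exponential.\<close>

lemma flow_mult_matrix_entry:
  "(flow M t ** M) $ i $ j = (\<Sum>n. matpow M (Suc n) $ i $ j / fact n * t ^ n)"
proof -
  have "(\<Sum>n. matpow M (Suc n) $ i $ j / fact n * t ^ n)
      = (\<Sum>n. \<Sum>k\<in>UNIV. (matpow M n $ i $ k / fact n * t ^ n) * M $ k $ j)"
    unfolding matpow_Suc_right
    by (simp add: matrix_matrix_mult_def sum_divide_distrib sum_distrib_left mult_ac times_divide_eq_right)
  also have "\<dots> = (\<Sum>k\<in>UNIV. \<Sum>n. (matpow M n $ i $ k / fact n * t ^ n) * M $ k $ j)"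
    by (intro suminf_sum summable_mult2 summable_flow)
  also have "\<dots> = (\<Sum>k\<in>UNIV. (\<Sum>n. matpow M n $ i $ k / fact n * t ^ n) * M $ k $ j)"
    by (intro sum.cong refl suminf_mult2[symmetric] summable_flow)
  finally show ?thesis by (simp add: matrix_matrix_mult_def flow_def)
qed

lemma flow_commute: "flow M t ** M = M ** flow M t"
  by (simp add: vec_eq_iff flow_mult_matrix_entry matrix_mult_flow_entry)

lemma flow_has_vector_derivative: "(flow M has_vector_derivative M ** flow M t) (at t)"
proof (intro has_vector_derivative_vecI)
  fix i j
  let ?c = "\<lambda>n. matpow M n $ i $ j / fact n"
  \<comment> \<open>The factor \<open>Suc n\<close> produced by differentiation cancels against
    \<open>fact (Suc n)\<close>.\<close>
  have "diffs ?c n = matpow M (Suc n) $ i $ j / fact n" for n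
    by (simp add: diffs_def del: matpow.simps)
  then have "((\<lambda>t. flow M t $ i $ j) has_real_derivative (M ** flow M t) $ i $ j) (at t)"
    using termdiffs_strong_converges_everywhere[of ?c t, OF summable_flow]
    unfolding matrix_mult_flow_entry by (simp add: flow_def del: matpow.simps)
  then show "((\<lambda>t. flow M t $ i $ j) has_vector_derivative (M ** flow M t) $ i $ j) (at t)"
    by (simp add: has_real_derivative_iff_has_vector_derivative)
qed

lemma flow_reverse_has_vector_derivative:
  "((\<lambda>s. flow M (t - s)) has_vector_derivative - (M ** flow M (t - s))) (at s)"
proof -
  have "((\<lambda>s. t - s) has_vector_derivative -1) (at s)"
    by (auto intro!: derivative_eq_intros)
  from vector_diff_chain_at[OF this flow_has_vector_derivative[of M "t - s"]]
  show ?thesis by (simp add: o_def)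
qed

lemma flow_vec_has_vector_derivative:
  "((\<lambda>t. flow M t *v v) has_vector_derivative M *v (flow M t *v v)) (at t)"
  using has_vector_derivative_matrix_vector
      [OF flow_has_vector_derivative[of M t] has_vector_derivative_const[of v]]
  by (simp add: matrix_vector_mul_assoc)

section \<open>The norm of a positive definite matrix\<close>

lemma qform_commute: "spd Q \<Longrightarrow> x \<bullet> (Q *v y) = y \<bullet> (Q *v x)"
  by (metis dot_lmul_matrix inner_commute spd_def transpose_matrix_vector)

lemma qform_nonneg: "spd Q \<Longrightarrow> 0 \<le> x \<bullet> (Q *v x)"
  by (cases "x = 0") (auto simp: spd_def less_imp_le)

lemma wnorm_nonneg [simp]: "spd Q \<Longrightarrow> 0 \<le> wnorm Q x"
  by (simp add: wnorm_def qform_nonneg)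

lemma wnorm_square: "spd Q \<Longrightarrow> (wnorm Q x)\<^sup>2 = x \<bullet> (Q *v x)"
  by (simp add: wnorm_def qform_nonneg)

lemma wnorm_0 [simp]: "wnorm Q 0 = 0"
  by (simp add: wnorm_def)

lemma wnorm_pos: "spd Q \<Longrightarrow> x \<noteq> 0 \<Longrightarrow> 0 < wnorm Q x"
  by (simp add: wnorm_def spd_def)

lemma wnorm_scaleR: "wnorm Q (c *\<^sub>R x) = \<bar>c\<bar> * wnorm Q x"
proof -
  have "(c *\<^sub>R x) \<bullet> (Q *v (c *\<^sub>R x)) = c\<^sup>2 * (x \<bullet> (Q *v x))"
    by (simp add: matrix_vector_mult_scaleR power2_eq_square)
  then show ?thesis by (simp add: wnorm_def real_sqrt_mult)
qed

lemma qform_Cauchy_Schwarz: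
  assumes "spd Q"
  shows "x \<bullet> (Q *v y) \<le> wnorm Q x * wnorm Q y"
proof (cases "y = 0")
  case False
  define q where "q = y \<bullet> (Q *v y)"
  define b where "b = x \<bullet> (Q *v y)"
  have "q > 0" using assms False by (simp add: spd_def q_def)
  \<comment> \<open>The component of \<open>x\<close> that is orthogonal to \<open>y\<close> in the
    inner product of \<open>Q\<close>; nonnegativity of its square is the inequality.\<close>
  let ?z = "x - (b / q) *\<^sub>R y"
  have "0 \<le> ?z \<bullet> (Q *v ?z)" using assms by (rule qform_nonneg)
  also have "\<dots> = x \<bullet> (Q *v x) - 2 * (b / q) * b + (b / q)\<^sup>2 * q"
    using qform_commute[OF assms, of y x]
    by (simp add: matrix_vector_mult_diff_distrib matrix_vector_mult_scaleR inner_diff_left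
        inner_diff_right b_def q_def power2_eq_square algebra_simps)
  also have "\<dots> = x \<bullet> (Q *v x) - b\<^sup>2 / q"
    using \<open>q > 0\<close> by (simp add: power2_eq_square field_simps)
  finally have "b\<^sup>2 \<le> (x \<bullet> (Q *v x)) * q"
    using \<open>q > 0\<close> by (simp add: field_simps)
  then have "b\<^sup>2 \<le> (wnorm Q x * wnorm Q y)\<^sup>2"
    using assms by (simp add: power_mult_distrib wnorm_square q_def)
  then show ?thesis
    unfolding b_def by (rule power2_le_imp_le) (simp add: assms)
qed simp

lemma wnorm_triangle:
  assumes "spd Q"
  shows "wnorm Q (x + y) \<le> wnorm Q x + wnorm Q y"
proof (rule power2_le_imp_le)
  have "(wnorm Q (x + y))\<^sup>2 = (wnorm Q x)\<^sup>2 + 2 * (x \<bullet> (Q *v y)) + (wnorm Q y)\<^sup>2"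
    using qform_commute[OF assms, of y x]
    by (simp add: wnorm_square assms matrix_vector_right_distrib inner_add_left inner_add_right)
  also have "\<dots> \<le> (wnorm Q x + wnorm Q y)\<^sup>2"
    using qform_Cauchy_Schwarz[OF assms, of x y] by (simp add: power2_sum)
  finally show "(wnorm Q (x + y))\<^sup>2 \<le> (wnorm Q x + wnorm Q y)\<^sup>2" .
qed (simp add: assms)

text \<open>Mean value inequality in the weighted norm, which replaces the integral in Duhamel's
  formula. Pairing \<open>p\<close> with the fixed vector \<open>w = p b - p a\<close> makes the
  problem scalar, and Cauchy-Schwarz makes \<open>h\<close> nonincreasing.\<close>

lemma wnorm_increment:
  fixes p :: "real \<Rightarrow> real^'n"
  assumes Q: "spd Q" and "a \<le> b"
    and p: "\<And>s. a \<le> s \<Longrightarrow> s \<le> b \<Longrightarrow> (p has_vector_derivative p' s) (at s)"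
    and \<phi>: "\<And>s. a \<le> s \<Longrightarrow> s \<le> b \<Longrightarrow> (\<phi> has_real_derivative \<phi>' s) (at s)"
    and le: "\<And>s. a \<le> s \<Longrightarrow> s \<le> b \<Longrightarrow> wnorm Q (p' s) \<le> \<phi>' s"
  shows "wnorm Q (p b - p a) \<le> \<phi> b - \<phi> a"
proof (cases "p b = p a")
  \<comment> \<open>A zero increment is treated apart, because the other case cancels a factor
    \<open>wnorm Q w\<close>.\<close>
  case True
  have "\<phi> a \<le> \<phi> b"
  proof (rule DERIV_nonneg_imp_nondecreasing[OF \<open>a \<le> b\<close>])
    fix s assume "a \<le> s" "s \<le> b"
    then show "\<exists>y. (\<phi> has_real_derivative y) (at s) \<and> 0 \<le> y"
      using \<phi> le[of s] wnorm_nonneg[OF Q, of "p' s"] by (meson order_trans)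
  qed
  then show ?thesis using True by simp
next
  case False
  define w where "w = p b - p a"
  define h where "h s = w \<bullet> (Q *v p s) - wnorm Q w * \<phi> s" for s
  have "h b \<le> h a"
  proof (rule DERIV_nonpos_imp_nonincreasing[OF \<open>a \<le> b\<close>])
    fix s assume s: "a \<le> s" "s \<le> b"
    have "((\<lambda>s. w \<bullet> (Q *v p s)) has_real_derivative w \<bullet> (Q *v p' s)) (at s)"
      unfolding has_real_derivative_iff_has_vector_derivative
      by (intro bounded_linear.has_vector_derivative[OF bounded_linear_inner_right]
          bounded_linear.has_vector_derivative[OF matrix_vector_mul_bounded_linear] p s)
    then have "(h has_real_derivative w \<bullet> (Q *v p' s) - wnorm Q w * \<phi>' s) (at s)"
      unfolding h_def by (auto intro!: derivative_eq_intros \<phi> s)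
    moreover have "w \<bullet> (Q *v p' s) \<le> wnorm Q w * \<phi>' s"
      using qform_Cauchy_Schwarz[OF Q, of w "p' s"] mult_left_mono[OF le[OF s], of "wnorm Q w"] Q
      by simp
    ultimately show "\<exists>y. (h has_real_derivative y) (at s) \<and> y \<le> 0" by force
  qed
  then have "(wnorm Q w)\<^sup>2 \<le> wnorm Q w * (\<phi> b - \<phi> a)"
    by (simp add: h_def wnorm_square Q algebra_simps)
      (simp add: w_def matrix_vector_mult_diff_distrib inner_diff_right algebra_simps)
  then have "wnorm Q w \<le> \<phi> b - \<phi> a"
    using wnorm_pos[OF Q, of w] False by (simp add: w_def power2_eq_square)
  then show ?thesis by (simp add: w_def)
qed

text \<open>\<open>V\<close> is nonincreasing. As the derivative may be missing at the finitely many
  times in \<open>F\<close>, this is read off from the fundamental theorem of calculus with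
  exceptional points. Bounding the quadratic form, and not the norm of \<open>f t\<close>, admits a
  negative \<open>L\<close>, so one lemma serves both the decay of the averaged flow and growth
  estimates.\<close>

lemma wnorm_Gronwall:
  fixes u :: "real \<Rightarrow> real^'n"
  assumes Q: "spd Q" and "finite F" and "a \<le> b" and cont: "continuous_on {a..b} u"
    and u: "\<And>t. t \<in> {a<..<b} - F \<Longrightarrow> (u has_vector_derivative f t) (at t)"
    and le: "\<And>t. t \<in> {a<..<b} - F \<Longrightarrow> u t \<bullet> (Q *v f t) \<le> L * (u t \<bullet> (Q *v u t))"
  shows "wnorm Q (u b) \<le> exp (L * (b - a)) * wnorm Q (u a)"
proof -
  define V where "V t = exp (- 2 * L * t) * (u t \<bullet> (Q *v u t))" for t
  \<comment> \<open>The value 0 at the exceptional points keeps the integrand of one sign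
    everywhere.\<close>
  define V' where "V' t = (if t \<in> {a<..<b} - F then
      exp (- 2 * L * t) * (2 * (u t \<bullet> (Q *v f t)) - 2 * L * (u t \<bullet> (Q *v u t))) else 0)" for t
  have "(V' has_integral V b - V a) {a..b}"
  proof (rule fundamental_theorem_of_calculus_interior_strong[OF \<open>finite F\<close> \<open>a \<le> b\<close>])
    show "continuous_on {a..b} V"
      unfolding V_def
      by (intro continuous_intros cont
          bounded_linear.continuous_on[OF matrix_vector_mul_bounded_linear])
    fix t assume t: "t \<in> {a<..<b} - F"
    have "((\<lambda>t. u t \<bullet> (Q *v u t)) has_real_derivative
        u t \<bullet> (Q *v f t) + f t \<bullet> (Q *v u t)) (at t)"
      unfolding has_real_derivative_iff_has_vector_derivative
      by (intro bounded_bilinear.has_vector_derivative[OF bounded_bilinear_inner]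
          bounded_linear.has_vector_derivative[OF matrix_vector_mul_bounded_linear] u t)
    then have "(V has_real_derivative V' t) (at t)"
      unfolding V_def V'_def using t qform_commute[OF Q, of "f t" "u t"]
      by (auto intro!: derivative_eq_intros simp: algebra_simps)
    then show "(V has_vector_derivative V' t) (at t)"
      by (simp add: has_real_derivative_iff_has_vector_derivative)
  qed
  then have "((\<lambda>t. - V' t) has_integral - (V b - V a)) {a..b}"
    by (rule has_integral_neg)
  moreover have "0 \<le> - V' t" for t
    using le[of t] by (auto simp: V'_def mult_le_0_iff)
  ultimately have "0 \<le> - (V b - V a)"
    by (rule has_integral_nonneg)
  then have "V b \<le> V a" by simp
  have "u b \<bullet> (Q *v u b) = exp (2 * L * b) * V b"
    unfolding V_def mult.assoc[symmetric] exp_add[symmetric] by simp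
  also have "\<dots> \<le> exp (2 * L * b) * V a"
    using \<open>V b \<le> V a\<close> by (intro mult_left_mono) auto
  also have "\<dots> = exp (2 * L * (b - a)) * (u a \<bullet> (Q *v u a))"
    unfolding V_def mult.assoc[symmetric] exp_add[symmetric] by (simp add: right_diff_distrib)
  also have "\<dots> = (exp (L * (b - a)))\<^sup>2 * (u a \<bullet> (Q *v u a))"
    by (simp add: power2_eq_square exp_add[symmetric])
  finally have "(wnorm Q (u b))\<^sup>2 \<le> (exp (L * (b - a)) * wnorm Q (u a))\<^sup>2"
    using Q by (simp add: wnorm_square power_mult_distrib)
  then show ?thesis by (rule power2_le_imp_le) (simp add: Q)
qed

lemma qform_le_of_wnorm_le:
  assumes Q: "spd Q" and "wnorm Q y \<le> c * wnorm Q x"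
  shows "x \<bullet> (Q *v y) \<le> c * (x \<bullet> (Q *v x))"
proof -
  have "x \<bullet> (Q *v y) \<le> wnorm Q x * (c * wnorm Q x)"
    using qform_Cauchy_Schwarz[OF Q, of x y] mult_left_mono[OF assms(2), of "wnorm Q x"] Q by simp
  also have "\<dots> = c * (x \<bullet> (Q *v x))"
    using wnorm_square[OF Q, of x] by (simp add: power2_eq_square)
  finally show ?thesis .
qed

lemma continuous_on_flow_vec: "continuous_on T (\<lambda>t. flow M t *v v)"
  by (rule continuous_on_vector_derivative)
    (rule has_vector_derivative_at_within[OF flow_vec_has_vector_derivative])

lemma wnorm_flow_dissipative:
  assumes "spd Q" "0 \<le> t" and le: "\<And>v. v \<bullet> (Q *v (M *v v)) \<le> L * (v \<bullet> (Q *v v))"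
  shows "wnorm Q (flow M t *v v) \<le> exp (L * t) * wnorm Q v"
proof -
  have "wnorm Q (flow M t *v v) \<le> exp (L * (t - 0)) * wnorm Q (flow M 0 *v v)"
    by (rule wnorm_Gronwall[where F = "{}", OF assms(1) _ assms(2) continuous_on_flow_vec
          flow_vec_has_vector_derivative]) (auto intro: le)
  then show ?thesis by simp
qed

lemma wnorm_flow_le:
  assumes "spd Q" "0 \<le> t" "\<And>v. wnorm Q (M *v v) \<le> \<mu> * wnorm Q v"
  shows "wnorm Q (flow M t *v v) \<le> exp (\<mu> * t) * wnorm Q v"
  by (rule wnorm_flow_dissipative[OF assms(1,2) qform_le_of_wnorm_le[OF assms(1,3)]])

text \<open>Gronwall for the difference \<open>?d\<close> of the two solutions, with
  \<open>mat 1\<close> as weight, that is, in the Euclidean norm. The difference vanishes at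
  \<open>a\<close>, so any finite rate \<open>K\<close> forces it to vanish at
  \<open>b\<close>.\<close>

lemma flow_unique:
  fixes u :: "real \<Rightarrow> real^'n"
  assumes "finite F" "a \<le> b" and cont: "continuous_on {a..b} u"
    and u: "\<And>t. t \<in> {a<..<b} - F \<Longrightarrow> (u has_vector_derivative M *v u t) (at t)"
  shows "u b = flow M (b - a) *v u a"
proof -
  have Q: "spd (mat 1 :: real^'n^'n)" by (simp add: spd_def transpose_mat)
  have wn: "wnorm (mat 1) v = norm v" for v :: "real^'n"
    by (simp add: wnorm_def norm_eq_sqrt_inner)
  let ?d = "\<lambda>t. u t - flow M (t - a) *v u a"
  obtain K where K: "\<And>v. norm (M *v v) \<le> norm v * K"
    using bounded_linear.bounded[OF matrix_vector_mul_bounded_linear[of M]] by blast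
  have "((\<lambda>t. flow M (t - a) *v u a) has_vector_derivative
      M *v (flow M (t - a) *v u a)) (at t)" for t
  proof -
    have "((\<lambda>t. t - a) has_vector_derivative 1) (at t)"
      by (auto intro!: derivative_eq_intros)
    from vector_diff_chain_at[OF this flow_vec_has_vector_derivative[of M "u a" "t - a"]]
    show ?thesis by (simp add: o_def)
  qed
  note fl = this
  have "wnorm (mat 1) (?d b) \<le> exp (K * (b - a)) * wnorm (mat 1) (?d a)"
  proof (rule wnorm_Gronwall[where f = "\<lambda>t. M *v ?d t", OF Q assms(1,2)])
    show "continuous_on {a..b} ?d"
      by (intro continuous_on_diff cont)
        (rule continuous_on_vector_derivative[OF has_vector_derivative_at_within[OF fl]])
  next
    fix t assume "t \<in> {a<..<b} - F"
    then show "(?d has_vector_derivative M *v ?d t) (at t)"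
      by (simp add: matrix_vector_mult_diff_distrib has_vector_derivative_diff u fl)
    show "?d t \<bullet> (mat 1 *v (M *v ?d t)) \<le> K * (?d t \<bullet> (mat 1 *v ?d t))"
      using K by (intro qform_le_of_wnorm_le Q) (simp add: wn mult.commute)
  qed
  then show ?thesis by (simp add: wn)
qed

section \<open>Products of exponentials\<close>

text \<open>Duhamel along \<open>?p\<close>, which runs from \<open>S\<close> after
  \<open>flow B s\<close> at \<open>r = 0\<close> to \<open>flow B s\<close> after \<open>S\<close>
  at \<open>r = s\<close>. The bounds of the two exponentials in \<open>?p'\<close> multiply to
  \<open>exp (\<beta> * s)\<close> for every \<open>r\<close>, and the interval has length
  \<open>s\<close>.\<close>

lemma wnorm_commutator_flow_le:
  assumes Q: "spd Q" and "0 \<le> s"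
    and B: "\<And>v. wnorm Q (B *v v) \<le> \<beta> * wnorm Q v"
    and C: "\<And>v. wnorm Q (commutator B S *v v) \<le> c * wnorm Q v"
    and "0 \<le> c"
  shows "wnorm Q (commutator (flow B s) S *v v) \<le> s * c * exp (\<beta> * s) * wnorm Q v"
proof -
  let ?p = "\<lambda>r. flow B r *v (S *v (flow B (s - r) *v v))"
  let ?p' = "\<lambda>r. flow B r *v (commutator B S *v (flow B (s - r) *v v))"
  let ?C = "c * exp (\<beta> * s) * wnorm Q v"
  have "wnorm Q (?p s - ?p 0) \<le> ?C * s - ?C * 0"
  proof (rule wnorm_increment[where p' = ?p' and \<phi>' = "\<lambda>_. ?C", OF Q \<open>0 \<le> s\<close>])
    fix r assume r: "0 \<le> r" "r \<le> s"
    have 1: "((\<lambda>r. flow B (s - r) *v v) has_vector_derivative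
        - ((B ** flow B (s - r)) *v v)) (at r)"
      using has_vector_derivative_matrix_vector[OF flow_reverse_has_vector_derivative[of B s r]
          has_vector_derivative_const[of v]]
      by (simp add: matrix_vector_mult_diff_rdistrib[of 0, simplified])
    \<comment> \<open>With \<open>B\<close> written to the right of \<open>flow B r\<close>, both
      terms share this left factor and what remains is the commutator of \<open>B\<close> and
      \<open>S\<close>.\<close>
    have "(?p has_vector_derivative
        (flow B r *v (S *v (- ((B ** flow B (s - r)) *v v))) +
         (flow B r ** B) *v (S *v (flow B (s - r) *v v)))) (at r)"
      unfolding flow_commute
      by (intro has_vector_derivative_matrix_vector flow_has_vector_derivative
          bounded_linear.has_vector_derivative[OF matrix_vector_mul_bounded_linear] 1)
    also have "flow B r *v (S *v (- ((B ** flow B (s - r)) *v v))) +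
         (flow B r ** B) *v (S *v (flow B (s - r) *v v)) = ?p' r"
      by (simp add: commutator_def matrix_vector_mul_assoc[symmetric] matrix_vector_mult_diff_distrib
          matrix_vector_mult_diff_rdistrib matrix_vector_mult_diff_distrib[of _ 0, simplified])
    finally show "(?p has_vector_derivative ?p' r) (at r)" .
    show "((\<lambda>r. ?C * r) has_real_derivative ?C) (at r)"
      by (auto intro!: derivative_eq_intros)
    have "wnorm Q (?p' r) \<le> exp (\<beta> * r) * (c * (exp (\<beta> * (s - r)) * wnorm Q v))"
    proof -
      have "wnorm Q (?p' r) \<le> exp (\<beta> * r) * wnorm Q (commutator B S *v (flow B (s - r) *v v))"
        using r by (intro wnorm_flow_le Q B) auto
      also have "\<dots> \<le> exp (\<beta> * r) * (c * wnorm Q (flow B (s - r) *v v))"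
        by (intro mult_left_mono C) auto
      also have "\<dots> \<le> exp (\<beta> * r) * (c * (exp (\<beta> * (s - r)) * wnorm Q v))"
        using r by (intro mult_left_mono wnorm_flow_le Q B \<open>0 \<le> c\<close>) auto
      finally show ?thesis .
    qed
    also have "\<dots> = c * (exp (\<beta> * r) * exp (\<beta> * (s - r))) * wnorm Q v" by simp
    also have "exp (\<beta> * r) * exp (\<beta> * (s - r)) = exp (\<beta> * s)"
      by (simp add: exp_add[symmetric] algebra_simps)
    finally show "wnorm Q (?p' r) \<le> ?C" .
  qed
  moreover have "?p s - ?p 0 = commutator (flow B s) S *v v"
    by (simp add: commutator_def matrix_vector_mult_diff_rdistrib matrix_vector_mul_assoc)
  ultimately show ?thesis by (simp add: mult_ac)
qed

text \<open>Duhamel along \<open>s \<mapsto> e\<^bsup>(1-s)(S+B)\<^esup> e\<^bsup>sB\<^esup> e\<^bsup>sS\<^esup>\<close>, whose derivative contains the commutator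
  of \<open>e\<^bsup>sB\<^esup>\<close> and \<open>S\<close>.\<close>

lemma wnorm_flow_mult_flow_diff_le:
  assumes Q: "spd Q"
    and B: "\<And>v. wnorm Q (B *v v) \<le> \<beta> * wnorm Q v"
    and S: "\<And>v. wnorm Q (S *v v) \<le> \<sigma> * wnorm Q v"
    and C: "\<And>v. wnorm Q (commutator B S *v v) \<le> c * wnorm Q v"
    and "0 \<le> c"
  shows "wnorm Q (flow B 1 *v (flow S 1 *v v) - flow (S + B) 1 *v v)
      \<le> 1 / 2 * c * exp (\<beta> + \<sigma>) * wnorm Q v"
proof -
  let ?p = "\<lambda>s. flow (S + B) (1 - s) *v (flow B s *v (flow S s *v v))"
  let ?p' = "\<lambda>s. flow (S + B) (1 - s) *v (commutator (flow B s) S *v (flow S s *v v))"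
  let ?C = "c * exp (\<beta> + \<sigma>) * wnorm Q v"
  \<comment> \<open>The bound on the commutator of \<open>flow B s\<close> and \<open>S\<close> is
    linear in \<open>s\<close>; its primitive over the unit interval is the source of the factor
    1/2.\<close>
  let ?\<phi> = "\<lambda>s::real. ?C * (s\<^sup>2 / 2)"
  have SB: "wnorm Q ((S + B) *v w) \<le> (\<beta> + \<sigma>) * wnorm Q w" for w
    using wnorm_triangle[OF Q, of "S *v w" "B *v w"] B[of w] S[of w]
    by (simp add: matrix_vector_mult_add_rdistrib algebra_simps)
  have "wnorm Q (?p 1 - ?p 0) \<le> ?\<phi> 1 - ?\<phi> 0"
  proof (rule wnorm_increment[where p' = ?p' and \<phi>' = "\<lambda>s. ?C * s", OF Q])
    fix s :: real assume s: "0 \<le> s" "s \<le> 1"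
    have "(?p has_vector_derivative
        flow (S + B) (1 - s) *v
          (flow B s *v (S *v (flow S s *v v)) + (B ** flow B s) *v (flow S s *v v))
        + (- (flow (S + B) (1 - s) ** (S + B))) *v (flow B s *v (flow S s *v v))) (at s)"
      unfolding flow_commute[of "S + B"]
      by (intro has_vector_derivative_matrix_vector flow_has_vector_derivative
          flow_reverse_has_vector_derivative flow_vec_has_vector_derivative)
    also have "flow (S + B) (1 - s) *v
          (flow B s *v (S *v (flow S s *v v)) + (B ** flow B s) *v (flow S s *v v))
        + (- (flow (S + B) (1 - s) ** (S + B))) *v (flow B s *v (flow S s *v v)) = ?p' s"
      by (simp add: commutator_def matrix_vector_mul_assoc[symmetric] matrix_vector_mult_diff_distrib
          matrix_vector_mult_diff_rdistrib matrix_vector_mult_add_rdistrib matrix_vector_right_distrib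
          matrix_vector_mult_diff_rdistrib[of 0, simplified])
    finally show "(?p has_vector_derivative ?p' s) (at s)" .
    show "(?\<phi> has_real_derivative ?C * s) (at s)"
      by (auto intro!: derivative_eq_intros)
    have "wnorm Q (?p' s)
        \<le> exp ((\<beta> + \<sigma>) * (1 - s)) * (s * c * exp (\<beta> * s) * (exp (\<sigma> * s) * wnorm Q v))"
    proof -
      have "wnorm Q (?p' s)
          \<le> exp ((\<beta> + \<sigma>) * (1 - s)) * wnorm Q (commutator (flow B s) S *v (flow S s *v v))"
        using s by (intro wnorm_flow_le Q SB) auto
      also have "\<dots> \<le> exp ((\<beta> + \<sigma>) * (1 - s)) * (s * c * exp (\<beta> * s) * wnorm Q (flow S s *v v))"
        using s by (intro mult_left_mono wnorm_commutator_flow_le Q B C \<open>0 \<le> c\<close>) auto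
      also have "\<dots> \<le> exp ((\<beta> + \<sigma>) * (1 - s)) * (s * c * exp (\<beta> * s) * (exp (\<sigma> * s) * wnorm Q v))"
        using s by (intro mult_left_mono wnorm_flow_le Q S mult_nonneg_nonneg \<open>0 \<le> c\<close>) auto
      finally show ?thesis .
    qed
    also have "\<dots> = c * (exp ((\<beta> + \<sigma>) * (1 - s)) * exp (\<beta> * s) * exp (\<sigma> * s)) * wnorm Q v * s"
      by simp
    also have "exp ((\<beta> + \<sigma>) * (1 - s)) * exp (\<beta> * s) * exp (\<sigma> * s) = exp (\<beta> + \<sigma>)"
      by (simp add: exp_add[symmetric] algebra_simps)
    finally show "wnorm Q (?p' s) \<le> ?C * s" .
  qed simp
  then show ?thesis by simp
qed

section \<open>Uniform bounds for weighted norms\<close>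

lemma sphere_nonempty: "sphere (0 :: real^'n) 1 \<noteq> {}"
proof -
  have "axis undefined 1 \<in> sphere (0 :: real^'n) 1" by (simp add: norm_axis_1)
  then show ?thesis by blast
qed

text \<open>The quadratic form is jointly continuous in matrix and vector, so it attains its extrema
  on the compact product of \<open>\<Q>\<close> with the unit sphere; the minimum is positive
  because it is attained. Homogeneity extends the bounds to all vectors.\<close>

lemma qform_uniform_bounds:
  fixes \<Q> :: "(real^'n^'n) set"
  assumes "compact \<Q>" and spd: "\<And>Q. Q \<in> \<Q> \<Longrightarrow> spd Q"
  obtains c C where "0 < c" "0 \<le> C"
    "\<And>Q x. Q \<in> \<Q> \<Longrightarrow> c * (norm x)\<^sup>2 \<le> x \<bullet> (Q *v x)"
    "\<And>Q x. Q \<in> \<Q> \<Longrightarrow> x \<bullet> (Q *v x) \<le> C * (norm x)\<^sup>2"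
proof (cases "\<Q> = {}")
  case True
  then show ?thesis using that[of 1 0] by simp
next
  case False
  let ?K = "\<Q> \<times> sphere (0 :: real^'n) 1"
  let ?f = "\<lambda>z. snd z \<bullet> (fst z *v snd z)"
  have K: "compact ?K" "?K \<noteq> {}"
    using False assms(1) sphere_nonempty by (auto intro: compact_Times)
  have f: "continuous_on ?K ?f"
    by (intro continuous_intros
        bounded_bilinear.continuous_on[OF bounded_bilinear_matrix_vector_mult])
  obtain z where z: "z \<in> ?K" "\<And>y. y \<in> ?K \<Longrightarrow> ?f z \<le> ?f y"
    using continuous_attains_inf[OF K f] by blast
  obtain z' where z': "z' \<in> ?K" "\<And>y. y \<in> ?K \<Longrightarrow> ?f y \<le> ?f z'"
    using continuous_attains_sup[OF K f] by blast
  have "0 < ?f z"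
  proof -
    have "fst z \<in> \<Q>" "snd z \<noteq> 0" using z(1) by auto
    then show ?thesis using spd unfolding spd_def by blast
  qed
  then have "0 \<le> ?f z'"
    using z'(2)[OF z(1)] by simp
  have scale: "x \<bullet> (Q *v x) = ?f (Q, x /\<^sub>R norm x) * (norm x)\<^sup>2" if "x \<noteq> 0" for x :: "real^'n" and Q
    using that by (simp add: matrix_vector_mult_scaleR power2_eq_square field_simps)
  have bounds: "?f z * (norm x)\<^sup>2 \<le> x \<bullet> (Q *v x) \<and> x \<bullet> (Q *v x) \<le> ?f z' * (norm x)\<^sup>2"
    if "Q \<in> \<Q>" for Q and x :: "real^'n"
  proof (cases "x = 0")
    case False
    then have "(Q, x /\<^sub>R norm x) \<in> ?K" using that by simp
    then show ?thesis
      unfolding scale[OF False] by (intro conjI mult_right_mono z(2) z'(2)) auto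
  qed simp
  show ?thesis
    using that[OF \<open>0 < ?f z\<close> \<open>0 \<le> ?f z'\<close>] bounds by blast
qed

text \<open>All weighted norms from a compact family are equivalent to the Euclidean norm with
  common constants, so one \<open>K\<close> serves every weight. A single weight and the image of
  \<open>P\<close> are the two families of interest.\<close>

lemma wnorm_mult_uniform_bound:
  fixes \<Q> :: "(real^'n^'n) set"
  assumes "compact \<Q>" and spd: "\<And>Q. Q \<in> \<Q> \<Longrightarrow> spd Q"
  obtains K where "0 \<le> K"
    "\<And>Q M v. Q \<in> \<Q> \<Longrightarrow> wnorm Q (M *v v) \<le> K * norm M * wnorm Q v"
proof -
  obtain c C where cC: "0 < c" "0 \<le> C"
    and lo: "\<And>Q x. Q \<in> \<Q> \<Longrightarrow> c * (norm x)\<^sup>2 \<le> x \<bullet> (Q *v x)"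
    and hi: "\<And>Q x. Q \<in> \<Q> \<Longrightarrow> x \<bullet> (Q *v x) \<le> C * (norm x)\<^sup>2"
    using qform_uniform_bounds[OF assms] by metis
  obtain B where B: "0 \<le> B" "\<And>(M :: real^'n^'n) v. norm (M *v v) \<le> norm M * norm v * B"
    using bounded_bilinear.nonneg_bounded[OF bounded_bilinear_matrix_vector_mult] by blast
  let ?K = "sqrt (C / c) * B"
  have "wnorm Q (M *v v) \<le> ?K * norm M * wnorm Q v" if Q: "Q \<in> \<Q>" for Q M v
  proof (rule power2_le_imp_le)
    have "(wnorm Q (M *v v))\<^sup>2 \<le> C * (norm (M *v v))\<^sup>2"
      using hi[OF Q] by (simp add: wnorm_square spd Q)
    also have "\<dots> \<le> C * (norm M * norm v * B)\<^sup>2"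
      by (intro mult_left_mono power_mono B cC) auto
    also have "\<dots> = C / c * B\<^sup>2 * (norm M)\<^sup>2 * (c * (norm v)\<^sup>2)"
      using cC by (simp add: power_mult_distrib)
    also have "\<dots> \<le> C / c * B\<^sup>2 * (norm M)\<^sup>2 * (v \<bullet> (Q *v v))"
      using cC by (intro mult_left_mono lo Q) auto
    also have "\<dots> = (?K * norm M * wnorm Q v)\<^sup>2"
      using cC by (simp add: power_mult_distrib wnorm_square spd Q)
    finally show "(wnorm Q (M *v v))\<^sup>2 \<le> (?K * norm M * wnorm Q v)\<^sup>2" .
  qed (use cC B spd Q in simp)
  moreover have "0 \<le> ?K" using cC B by simp
  ultimately show ?thesis using that by blast
qed

lemma wnorm_mult_le_wopnorm:
  assumes Q: "spd Q"
  shows "wnorm Q (M *v v) \<le> wopnorm Q M * wnorm Q v"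
proof (cases "v = 0")
  case False
  \<comment> \<open>A real \<open>SUP\<close> is known to dominate its members only over a bounded
    set; the one-element family of weights supplies the bound.\<close>
  obtain K where K: "\<And>M v. wnorm Q (M *v v) \<le> K * norm M * wnorm Q v"
    using wnorm_mult_uniform_bound[of "{Q}"] Q by (metis compact_sing singletonD singletonI)
  have "wnorm Q (M *v v) / wnorm Q v \<le> wopnorm Q M"
    unfolding wopnorm_def
  proof (rule cSUP_upper)
    show "bdd_above ((\<lambda>x. wnorm Q (M *v x) / wnorm Q x) ` {x. x \<noteq> 0})"
      using K wnorm_pos[OF Q] by (intro bdd_aboveI2[of _ _ "K * norm M"]) (simp add: divide_le_eq)
  qed (use False in simp)
  then show ?thesis using wnorm_pos[OF Q False] by (simp add: divide_le_eq)
qed simp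

lemma wopnorm_le:
  fixes Q :: "real^'n^'n"
  assumes Q: "spd Q" and le: "\<And>v. wnorm Q (M *v v) \<le> c * wnorm Q v"
  shows "wopnorm Q M \<le> c"
  unfolding wopnorm_def
proof (rule cSUP_least)
  \<comment> \<open>The index type is nonempty, so a nonzero vector exists and the supremum is not
    over the empty set.\<close>
  have "axis undefined 1 \<noteq> (0 :: real^'n)" by (simp add: axis_eq_0_iff)
  then show "{x :: real^'n. x \<noteq> 0} \<noteq> {}" by blast
qed (use le wnorm_pos[OF Q] in \<open>simp add: divide_le_eq\<close>)

lemma wopnorm_nonneg:
  fixes Q :: "real^'n^'n"
  assumes Q: "spd Q"
  shows "0 \<le> wopnorm Q M"
proof -
  let ?v = "axis undefined 1 :: real^'n"
  have "0 \<le> wopnorm Q M * wnorm Q ?v"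
    using wnorm_mult_le_wopnorm[OF Q] wnorm_nonneg[OF Q] order_trans by blast
  then show ?thesis
    using wnorm_pos[OF Q, of ?v] by (simp add: axis_eq_0_iff zero_le_mult_iff)
qed

section \<open>The one-period contraction\<close>

lemma g_mono: "z \<le> w \<Longrightarrow> g z \<le> g w"
  \<comment> \<open>The comparison is pointwise under the integral, since \<open>s\<close> and
    \<open>1 - s\<close> are nonnegative on the unit interval.\<close>
  unfolding g_def
  by (intro integral_le integrable_continuous_real continuous_intros mult_left_mono)
    (auto intro: mult_right_mono)

lemma g_0: "g 0 = 1 / 2"
proof -
  have "((\<lambda>s::real. 1 - s) has_integral (1 - 1\<^sup>2 / 2) - (0 - 0\<^sup>2 / 2)) {0..1}"
    by (rule fundamental_theorem_of_calculus)
      (auto intro!: derivative_eq_intros simp flip: has_real_derivative_iff_has_vector_derivative)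
  then show ?thesis
    unfolding g_def by (simp add: integral_unique)
qed

lemma g_ge_half: "0 \<le> z \<Longrightarrow> 1 / 2 \<le> g z"
  using g_mono[of 0 z] by (simp add: g_0)

section \<open>Commutators of sums and the telescoped product of exponentials\<close>

lemma commutator_scaleR: "commutator (a *\<^sub>R X) (b *\<^sub>R Y) = (a * b) *\<^sub>R commutator X Y"
proof -
  have "(a *\<^sub>R X) ** (b *\<^sub>R Y) = (a * b) *\<^sub>R (X ** Y)" for a b and X Y :: "real^'a^'a"
    by (simp add: matrix_scalar_ac scalar_matrix_assoc[symmetric])
  then show ?thesis
    by (simp add: commutator_def scaleR_diff_right mult.commute)
qed

lemma matrix_add_rdistrib: "(X + Y) ** Z = X ** Z + Y ** Z"
  for X Y :: "real^'n^'m"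
  by (simp add: matrix_matrix_mult_def vec_eq_iff distrib_right sum.distrib)

lemma matrix_mult_sum_right: "X ** (\<Sum>i\<in>I. Y i) = (\<Sum>i\<in>I. X ** Y i)" for X :: "real^'n^'n"
  by (induction I rule: infinite_finite_induct) (auto simp: matrix_add_ldistrib)

lemma matrix_mult_sum_left: "(\<Sum>i\<in>I. Y i) ** X = (\<Sum>i\<in>I. Y i ** X)" for X :: "real^'n^'n"
  by (induction I rule: infinite_finite_induct) (auto simp: matrix_add_rdistrib)

lemma commutator_sum: "commutator X (\<Sum>i\<in>I. Y i) = (\<Sum>i\<in>I. commutator X (Y i))"
  by (simp add: commutator_def matrix_mult_sum_right matrix_mult_sum_left sum_subtractf)

lemma wnorm_sum_mult_le:
  assumes Q: "spd Q" and le: "\<And>i. i \<in> I \<Longrightarrow> wnorm Q (Y i *v v) \<le> c i * wnorm Q v"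
  shows "wnorm Q ((\<Sum>i\<in>I. Y i) *v v) \<le> (\<Sum>i\<in>I. c i) * wnorm Q v"
  using le
proof (induction I rule: infinite_finite_induct)
  case (insert i I)
  have "wnorm Q ((\<Sum>i\<in>insert i I. Y i) *v v)
      \<le> wnorm Q (Y i *v v) + wnorm Q ((\<Sum>i\<in>I. Y i) *v v)"
    using insert by (simp add: matrix_vector_mult_add_rdistrib wnorm_triangle Q)
  also have "\<dots> \<le> c i * wnorm Q v + (\<Sum>i\<in>I. c i) * wnorm Q v"
    using insert by (intro add_mono) auto
  finally show ?case using insert by (simp add: algebra_simps)
qed auto

text \<open>The telescoping, as an induction on the number of factors. The length of the period is
  to be absorbed into the matrices, so every flow runs for time 1. The recursion for
  \<open>y\<close> is all that is asked of the orbit, so the values of a solution at its switching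
  times can be inserted.\<close>

lemma wnorm_product_flow_diff_le:
  fixes B :: "nat \<Rightarrow> real^'n^'n"
  assumes Q: "spd Q"
    and B: "\<And>i v. wnorm Q (B i *v v) \<le> \<beta> i * wnorm Q v"
    and C: "\<And>i k v. wnorm Q (commutator (B k) (B i) *v v) \<le> c i k * wnorm Q v"
    and c: "\<And>i k. 0 \<le> c i k"
    and y: "\<And>j. j < m \<Longrightarrow> y (Suc j) = flow (B (Suc j)) 1 *v y j"
  shows "j \<le> m \<Longrightarrow> wnorm Q (y j - flow (\<Sum>i=1..j. B i) 1 *v y 0)
    \<le> exp (\<Sum>i=1..j. \<beta> i) * (\<Sum>k=1..j. 1 / 2 * (\<Sum>i=1..k-1. c i k)) * wnorm Q (y 0)"
proof (induction j)
  case 0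
  \<comment> \<open>Scaling by 0 turns time 1 into time 0, where the flow is the identity.\<close>
  have "flow (0 :: real^'n^'n) 1 = mat 1" using flow_scaleR[of 0 0 1] by simp
  then show ?case by simp
next
  case (Suc j)
  let ?S = "\<Sum>i=1..j. B i" and ?s = "\<Sum>i=1..j. \<beta> i" and ?b = "\<beta> (Suc j)" and ?w = "wnorm Q (y 0)"
  let ?X = "\<Sum>k=1..j. 1 / 2 * (\<Sum>i=1..k-1. c i k)" and ?c = "\<Sum>i=1..j. c i (Suc j)"
  let ?E = "flow (B (Suc j)) 1"
  \<comment> \<open>The old error is carried along by the new factor, and the second summand is the
    new error of merging two exponentials into one.\<close>
  have "y (Suc j) - flow (\<Sum>i=1..Suc j. B i) 1 *v y 0
      = ?E *v (y j - flow ?S 1 *v y 0)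
        + (?E *v (flow ?S 1 *v y 0) - flow (?S + B (Suc j)) 1 *v y 0)"
    using y Suc.prems by (simp add: matrix_vector_mult_diff_distrib)
  then have "wnorm Q (y (Suc j) - flow (\<Sum>i=1..Suc j. B i) 1 *v y 0)
      \<le> wnorm Q (?E *v (y j - flow ?S 1 *v y 0))
        + wnorm Q (?E *v (flow ?S 1 *v y 0) - flow (?S + B (Suc j)) 1 *v y 0)"
    by (simp only: wnorm_triangle Q)
  also have "\<dots> \<le> exp (?b * 1) * (exp ?s * ?X * ?w) + 1 / 2 * ?c * exp (?b + ?s) * ?w"
  proof (rule add_mono)
    have "wnorm Q (?E *v (y j - flow ?S 1 *v y 0))
        \<le> exp (?b * 1) * wnorm Q (y j - flow ?S 1 *v y 0)"
      by (intro wnorm_flow_le Q B) simp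
    also have "\<dots> \<le> exp (?b * 1) * (exp ?s * ?X * ?w)"
      using Suc by (intro mult_left_mono) auto
    finally show "wnorm Q (?E *v (y j - flow ?S 1 *v y 0)) \<le> exp (?b * 1) * (exp ?s * ?X * ?w)" .
    show "wnorm Q (?E *v (flow ?S 1 *v y 0) - flow (?S + B (Suc j)) 1 *v y 0)
        \<le> 1 / 2 * ?c * exp (?b + ?s) * ?w"
      by (intro wnorm_flow_mult_flow_diff_le Q B sum_nonneg c)
        (auto simp: commutator_sum intro!: wnorm_sum_mult_le Q B C)
  qed
  also have "\<dots> = exp (\<Sum>i=1..Suc j. \<beta> i) * (\<Sum>k=1..Suc j. 1 / 2 * (\<Sum>i=1..k-1. c i k)) * ?w"
    by (simp add: exp_add algebra_simps)
  finally show ?case .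
qed

section \<open>Weights and the switching signal\<close>

context
  fixes m :: nat and \<alpha> :: "nat \<Rightarrow> real"
  assumes \<alpha>: "\<alpha> \<in> weight_simplex m"
begin

lemma weight_nonneg: "0 \<le> \<alpha> i"
  using \<alpha> by (cases "i \<in> {1..m}") (auto simp: weight_simplex_def)

lemma partial_weight_mono: "I \<subseteq> J \<Longrightarrow> finite J \<Longrightarrow> sum \<alpha> I \<le> sum \<alpha> J"
  by (intro sum_mono2) (auto simp: weight_nonneg)

lemma weight_sum: "(\<Sum>i=1..m. \<alpha> i) = 1"
  using \<alpha> by (simp add: weight_simplex_def)

lemma weight_dim_pos: "0 < m"
  using weight_sum by (cases m) auto

lemma weight_le_1: "\<alpha> i \<le> 1"
proof (cases "i \<in> {1..m}")
  case True
  then show ?thesis using partial_weight_mono[of "{i}" "{1..m}"] weight_sum by simp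
qed (use \<alpha> in \<open>auto simp: weight_simplex_def\<close>)

text \<open>Discharges the uniqueness behind \<open>THE\<close>: every mode interval lies inside its
  own period, which determines \<open>k\<close>, and within one period the intervals of distinct
  modes are disjoint by the order of the partial sums.\<close>

lemma switching_signal_eq:
  assumes "0 < \<tau>" and i: "i \<in> {1..m}"
    and t: "real k * \<tau> + \<tau> * (\<Sum>j=1..<i. \<alpha> j) \<le> t" "t < real k * \<tau> + \<tau> * (\<Sum>j=1..i. \<alpha> j)"
  shows "switching_signal m \<alpha> \<tau> t = i"
proof -
  have period: "real k * \<tau> \<le> t \<and> t < (real k + 1) * \<tau>"
    if "i \<in> {1..m}" "real k * \<tau> + \<tau> * (\<Sum>j=1..<i. \<alpha> j) \<le> t"
      "t < real k * \<tau> + \<tau> * (\<Sum>j=1..i. \<alpha> j)" for i k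
  proof
    have "0 \<le> \<tau> * (\<Sum>j=1..<i. \<alpha> j)"
      using \<open>0 < \<tau>\<close> by (intro mult_nonneg_nonneg sum_nonneg) (auto simp: weight_nonneg)
    then show "real k * \<tau> \<le> t" using that by linarith
    have "\<tau> * (\<Sum>j=1..i. \<alpha> j) \<le> \<tau> * 1"
      using \<open>0 < \<tau>\<close> that partial_weight_mono[of "{1..i}" "{1..m}"] weight_sum
      by (intro mult_left_mono) auto
    then show "t < (real k + 1) * \<tau>" using that by (simp add: algebra_simps)
  qed
  have same_period: "k = k'" if "real k * \<tau> \<le> t \<and> t < (real k + 1) * \<tau>"
    "real k' * \<tau> \<le> t \<and> t < (real k' + 1) * \<tau>" for k k'
  proof -
    have "real k * \<tau> < (real k' + 1) * \<tau>" "real k' * \<tau> < (real k + 1) * \<tau>"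
      using that by linarith+
    then show ?thesis using \<open>0 < \<tau>\<close> by simp
  qed
  have ordered: "\<not> i < i'"
    if "t < real k * \<tau> + \<tau> * (\<Sum>j=1..i. \<alpha> j)" "real k * \<tau> + \<tau> * (\<Sum>j=1..<i'. \<alpha> j) \<le> t" for i i' k
  proof
    assume "i < i'"
    then have "\<tau> * (\<Sum>j=1..i. \<alpha> j) \<le> \<tau> * (\<Sum>j=1..<i'. \<alpha> j)"
      using \<open>0 < \<tau>\<close> by (intro mult_left_mono partial_weight_mono) auto
    then show False using that by linarith
  qed
  show ?thesis
    unfolding switching_signal_def
  proof (rule the_equality)
    show "i \<in> {1..m} \<and> (\<exists>k::nat. t \<in> {real k * \<tau> + \<tau> * (\<Sum>j=1..<i. \<alpha> j) ..<
        real k * \<tau> + \<tau> * (\<Sum>j=1..i. \<alpha> j)})"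
      using i t by auto
  next
    fix i'
    assume "i' \<in> {1..m} \<and> (\<exists>k::nat. t \<in> {real k * \<tau> + \<tau> * (\<Sum>j=1..<i'. \<alpha> j) ..<
        real k * \<tau> + \<tau> * (\<Sum>j=1..i'. \<alpha> j)})"
    then obtain k' :: nat where i': "i' \<in> {1..m}"
      and t': "real k' * \<tau> + \<tau> * (\<Sum>j=1..<i'. \<alpha> j) \<le> t"
        "t < real k' * \<tau> + \<tau> * (\<Sum>j=1..i'. \<alpha> j)" by auto
    have "k' = k" using same_period period[OF i t] period[OF i' t'] by blast
    then show "i' = i"
      using ordered[OF t(2), of i'] ordered[OF t'(2), of i] t(1) t'(1)
      by (metis linorder_neqE_nat)
  qed
qed

text \<open>Existence behind \<open>THE\<close>: at every time the active matrix is one of those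
  over which \<open>growth\<close> takes its maximum.\<close>

lemma switching_signal_in:
  assumes "0 < \<tau>" "0 \<le> s" "s < \<tau>"
  shows "switching_signal m \<alpha> \<tau> (real k * \<tau> + s) \<in> {1..m}"
proof -
  let ?P = "\<lambda>i. s < \<tau> * (\<Sum>j=1..i. \<alpha> j)"
  have P: "?P m" unfolding weight_sum using assms by simp
  \<comment> \<open>The first mode that ends after \<open>s\<close>. Minimality says that the
    preceding mode has ended by \<open>s\<close>, which also passes over modes of weight 0; and
    \<open>i\<close> is not 0 because the empty sum vanishes.\<close>
  define i where "i = (LEAST i. ?P i)"
  have "?P i" using LeastI[of ?P, OF P] by (simp add: i_def)
  moreover have "i \<le> m" using Least_le[of ?P, OF P] by (simp add: i_def)
  moreover have "i \<noteq> 0" using \<open>?P i\<close> assms by (intro notI) simp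
  moreover have "\<not> ?P (i - 1)"
    using not_less_Least[of "i - 1" ?P] \<open>i \<noteq> 0\<close> by (simp add: i_def)
  moreover have "{1..i - 1} = {1..<i}" using \<open>i \<noteq> 0\<close> by auto
  ultimately have "switching_signal m \<alpha> \<tau> (real k * \<tau> + s) = i"
    by (intro switching_signal_eq[where k = k] assms) auto
  then show ?thesis using \<open>i \<le> m\<close> \<open>i \<noteq> 0\<close> by simp
qed

end

section \<open>Solutions over one mode and over one period\<close>

lemma switched_solution_on:
  assumes "switched_solution m A \<alpha> \<tau> x" "0 \<le> a" "a \<le> b"
  obtains F where "finite F" "continuous_on {a..b} x"
    "\<And>t. t \<in> {a<..<b} - F \<Longrightarrow>
      (x has_vector_derivative A (switching_signal m \<alpha> \<tau> t) *v x t) (at t)"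
proof -
  have "0 \<le> b" using assms by simp
  then obtain F where "finite F" and F: "\<And>t. t \<in> {0..b} - F \<Longrightarrow>
      (x has_vector_derivative A (switching_signal m \<alpha> \<tau> t) *v x t) (at t within {0..})"
    using assms(1) unfolding switched_solution_def by blast
  have cont: "continuous_on {a..b} x"
    using assms continuous_on_subset[of "{0..}" x "{a..b}"] by (auto simp: switched_solution_def)
  have "(x has_vector_derivative A (switching_signal m \<alpha> \<tau> t) *v x t) (at t)"
    if "t \<in> {a<..<b} - F" for t
  proof -
    \<comment> \<open>Times beyond \<open>a\<close> are positive, so the derivative within the
      half-line is two-sided there.\<close>
    have "at t within {0..} = at t"
      using that \<open>0 \<le> a\<close> by (intro at_within_interior) (simp add: interior_real_atLeast)
    then show ?thesis using F[of t] that \<open>0 \<le> a\<close> by simp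
  qed
  then show ?thesis using that \<open>finite F\<close> cont by blast
qed

text \<open>On the open interval of a mode the signal is constant and uniqueness for the linear
  equation applies. For a mode of weight 0 the interval degenerates and the flow is the
  identity.\<close>

lemma switched_solution_mode_step:
  assumes \<alpha>: "\<alpha> \<in> weight_simplex m" and "0 < \<tau>" and x: "switched_solution m A \<alpha> \<tau> x"
    and "j < m"
  shows "x (real k * \<tau> + \<tau> * (\<Sum>i=1..Suc j. \<alpha> i))
    = flow (\<tau> *\<^sub>R scaled_mode A \<alpha> (Suc j)) 1 *v x (real k * \<tau> + \<tau> * (\<Sum>i=1..j. \<alpha> i))"
proof -
  let ?a = "real k * \<tau> + \<tau> * (\<Sum>i=1..j. \<alpha> i)"
  let ?b = "real k * \<tau> + \<tau> * (\<Sum>i=1..Suc j. \<alpha> i)"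
  have len: "?b - ?a = \<tau> * \<alpha> (Suc j)" by (simp add: algebra_simps)
  have "0 \<le> ?a"
    using \<open>0 < \<tau>\<close> by (intro add_nonneg_nonneg mult_nonneg_nonneg sum_nonneg)
      (auto simp: weight_nonneg[OF \<alpha>])
  moreover have "?a \<le> ?b"
    using len \<open>0 < \<tau>\<close> weight_nonneg[OF \<alpha>, of "Suc j"] mult_nonneg_nonneg[of \<tau> "\<alpha> (Suc j)"] by linarith
  ultimately obtain F where "finite F" "continuous_on {?a..?b} x"
    and F: "\<And>t. t \<in> {?a<..<?b} - F \<Longrightarrow>
      (x has_vector_derivative A (switching_signal m \<alpha> \<tau> t) *v x t) (at t)"
    using switched_solution_on[OF x] by metis
  have "(x has_vector_derivative A (Suc j) *v x t) (at t)" if t: "t \<in> {?a<..<?b} - F" for t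
  proof -
    have "switching_signal m \<alpha> \<tau> t = Suc j"
      using t \<open>j < m\<close>
      by (intro switching_signal_eq[OF \<alpha> \<open>0 < \<tau>\<close>, where k = k])
        (auto simp: atLeastLessThanSuc_atLeastAtMost)
    then show ?thesis using F[OF t] by simp
  qed
  then have "x ?b = flow (A (Suc j)) (?b - ?a) *v x ?a"
    by (rule flow_unique[OF \<open>finite F\<close> \<open>?a \<le> ?b\<close> \<open>continuous_on {?a..?b} x\<close>])
  then show ?thesis
    unfolding len by (simp add: scaled_mode_def flow_scaleR)
qed

text \<open>Both summands of the Lyapunov expression have the same quadratic form, so the factor 2
  cancels.\<close>

lemma dissipative_of_loewner_le:
  assumes Q: "spd Q"
    and "loewner_le (transpose S ** Q + Q ** S) ((- 2 * \<eta>) *\<^sub>R Q)"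
  shows "v \<bullet> (Q *v (S *v v)) \<le> - \<eta> * (v \<bullet> (Q *v v))"
proof -
  have "v \<bullet> ((transpose S ** Q) *v v) = v \<bullet> (Q *v (S *v v))"
  proof -
    have "v \<bullet> ((transpose S ** Q) *v v) = (S *v v) \<bullet> (Q *v v)"
      by (metis dot_lmul_matrix matrix_vector_mul_assoc transpose_matrix_vector transpose_transpose)
    then show ?thesis using qform_commute[OF Q] by metis
  qed
  moreover have "0 \<le> v \<bullet> (((- 2 * \<eta>) *\<^sub>R Q - (transpose S ** Q + Q ** S)) *v v)"
    using assms(2) by (simp add: loewner_le_def psd_def)
  ultimately show ?thesis
    by (simp add: matrix_vector_mult_diff_rdistrib matrix_vector_mult_add_rdistrib inner_diff_right
        inner_add_right scaleR_matrix_vector_assoc[symmetric] matrix_vector_mul_assoc[symmetric]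
        matrix_vector_mult_diff_rdistrib[of 0, simplified])
qed

text \<open>Makes \<open>kappa\<close> positive, so that its supremum has monotone powers and a
  logarithm.\<close>

lemma kappa_ge:
  assumes Q: "spd (P \<alpha>)" and "0 < \<tau>"
  shows "exp (- \<eta> * \<tau>) \<le> kappa m A P \<eta> \<tau> \<alpha>"
proof -
  have "0 \<le> g (\<tau> * mode_norm A P \<alpha> k)" for k
    using g_ge_half[of "\<tau> * mode_norm A P \<alpha> k"] wopnorm_nonneg[OF Q] \<open>0 < \<tau>\<close>
    by (simp add: mode_norm_def)
  then show ?thesis
    by (auto simp: kappa_def comm_norm_def wopnorm_nonneg[OF Q]
        intro!: sum_nonneg mult_nonneg_nonneg)
qed

lemma wnorm_period_le:
  fixes A :: "nat \<Rightarrow> real^'n^'n"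
  assumes \<alpha>: "\<alpha> \<in> weight_simplex m" and "0 < \<tau>" and x: "switched_solution m A \<alpha> \<tau> x"
    and Q: "spd (P \<alpha>)"
    and "loewner_le (transpose (mean_matrix m A \<alpha>) ** P \<alpha> + P \<alpha> ** mean_matrix m A \<alpha>)
           ((- 2 * \<eta>) *\<^sub>R P \<alpha>)"
  shows "wnorm (P \<alpha>) (x (real (Suc k) * \<tau>)) \<le> kappa m A P \<eta> \<tau> \<alpha> * wnorm (P \<alpha>) (x (real k * \<tau>))"
proof -
  let ?Q = "P \<alpha>" and ?B = "\<lambda>i. \<tau> *\<^sub>R scaled_mode A \<alpha> i"
  define \<beta> where "\<beta> i = \<tau> * mode_norm A P \<alpha> i" for i
  define c where "c i k = \<tau>\<^sup>2 * comm_norm A P \<alpha> i k" for i k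
  \<comment> \<open>The solution at the switching times of period \<open>k\<close>; since the
    weights sum to 1, \<open>y 0\<close> and \<open>y m\<close> belong to the two ends of the
    period.\<close>
  define y where "y j = x (real k * \<tau> + \<tau> * (\<Sum>i=1..j. \<alpha> i))" for j
  let ?w = "wnorm ?Q (y 0)" and ?F = "flow (\<Sum>i=1..m. ?B i) 1 *v y 0"
  have B: "wnorm ?Q (?B i *v v) \<le> \<beta> i * wnorm ?Q v" for i v
    using wnorm_mult_le_wopnorm[OF Q, of "scaled_mode A \<alpha> i" v] \<open>0 < \<tau>\<close>
    by (simp add: scaleR_matrix_vector_assoc[symmetric] wnorm_scaleR \<beta>_def mode_norm_def)
  have C: "wnorm ?Q (commutator (?B k) (?B i) *v v) \<le> c i k * wnorm ?Q v" for i k v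
    using wnorm_mult_le_wopnorm[OF Q, of "commutator (scaled_mode A \<alpha> k) (scaled_mode A \<alpha> i)" v]
      \<open>0 < \<tau>\<close>
    by (simp add: commutator_scaleR scaleR_matrix_vector_assoc[symmetric] wnorm_scaleR c_def
        comm_norm_def power2_eq_square)
  have "0 \<le> c i k" for i k
    by (simp add: c_def comm_norm_def wopnorm_nonneg[OF Q])
  have half: "1 / 2 \<le> g (\<tau> * mode_norm A P \<alpha> k)" for k
    using \<open>0 < \<tau>\<close> by (intro g_ge_half) (simp add: mode_norm_def wopnorm_nonneg[OF Q])
  have "wnorm ?Q (y m - ?F)
      \<le> exp (\<Sum>i=1..m. \<beta> i) * (\<Sum>k=1..m. 1 / 2 * (\<Sum>i=1..k-1. c i k)) * ?w"
    by (rule wnorm_product_flow_diff_le[where m = m, OF Q B C \<open>\<And>k i. 0 \<le> c i k\<close> _ order_refl])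
      (unfold y_def, rule switched_solution_mode_step[OF \<alpha> \<open>0 < \<tau>\<close> x])
  also have "\<dots> \<le> exp (\<Sum>i=1..m. \<beta> i)
      * (\<Sum>k=1..m. g (\<tau> * mode_norm A P \<alpha> k) * (\<Sum>i=1..k-1. c i k)) * ?w"
    using half \<open>\<And>k i. 0 \<le> c i k\<close> Q
    by (intro mult_right_mono mult_left_mono sum_mono sum_nonneg) auto
  \<comment> \<open>The inner sum is empty for \<open>k = 1\<close>, so the outer sum may start at
    2.\<close>
  also have "(\<Sum>k=1..m. g (\<tau> * mode_norm A P \<alpha> k) * (\<Sum>i=1..k-1. c i k))
      = (\<Sum>k=2..m. g (\<tau> * mode_norm A P \<alpha> k) * (\<Sum>i=1..k-1. c i k))"
    by (rule sum.mono_neutral_right) (auto simp: Suc_le_eq intro!: sum.neutral)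
  also have "\<dots> = \<tau>\<^sup>2 * (\<Sum>k=2..m. g (\<tau> * mode_norm A P \<alpha> k) * (\<Sum>i=1..k-1. comm_norm A P \<alpha> i k))"
    by (simp add: c_def sum_distrib_left mult_ac)
  also have "(\<Sum>i=1..m. \<beta> i) = \<tau> * total_norm m A P \<alpha>"
    by (simp add: \<beta>_def total_norm_def sum_distrib_left)
  finally have diff: "wnorm ?Q (y m - ?F) \<le> (kappa m A P \<eta> \<tau> \<alpha> - exp (- \<eta> * \<tau>)) * ?w"
    by (simp add: kappa_def mult_ac)
  have "(\<Sum>i=1..m. ?B i) = \<tau> *\<^sub>R mean_matrix m A \<alpha>"
    by (simp add: mean_matrix_def scaleR_sum_right)
  then have "wnorm ?Q ?F \<le> exp (- \<eta> * \<tau>) * ?w"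
    using wnorm_flow_dissipative[OF Q _ dissipative_of_loewner_le[OF Q assms(5)], of \<tau> "y 0"] \<open>0 < \<tau>\<close>
    by (simp add: flow_scaleR)
  moreover have "wnorm ?Q (y m) \<le> wnorm ?Q (y m - ?F) + wnorm ?Q ?F"
    using wnorm_triangle[OF Q, of "y m - ?F" ?F] by simp
  ultimately have "wnorm ?Q (y m) \<le> kappa m A P \<eta> \<tau> \<alpha> * ?w"
    using diff by (simp add: algebra_simps)
  moreover have "y m = x (real (Suc k) * \<tau>)"
    unfolding y_def weight_sum[OF \<alpha>] by (simp add: algebra_simps)
  ultimately show ?thesis by (simp add: y_def)
qed

section \<open>Growth between sampling times and finiteness of the suprema\<close>

lemma wopnorm_le_growth: "i \<in> {1..m} \<Longrightarrow> wopnorm (P \<alpha>) (A i) \<le> growth m A P \<alpha>"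
  by (auto simp: growth_def)

text \<open>Gronwall with one rate that is valid for every mode crosses all switching times inside
  the period at once.\<close>

lemma wnorm_intersample_le:
  assumes \<alpha>: "\<alpha> \<in> weight_simplex m" and "0 < \<tau>" and x: "switched_solution m A \<alpha> \<tau> x"
    and Q: "spd (P \<alpha>)" and s: "0 \<le> s" "s < \<tau>" and "growth m A P \<alpha> \<le> \<Gamma>"
  shows "wnorm (P \<alpha>) (x (real k * \<tau> + s)) \<le> exp (s * \<Gamma>) * wnorm (P \<alpha>) (x (real k * \<tau>))"
proof -
  let ?a = "real k * \<tau>"
  have "0 \<le> ?a" "?a \<le> ?a + s" using \<open>0 < \<tau>\<close> s by simp_all
  then obtain F where F: "finite F" "continuous_on {?a..?a + s} x"
    "\<And>t. t \<in> {?a<..<?a + s} - F \<Longrightarrow>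
      (x has_vector_derivative A (switching_signal m \<alpha> \<tau> t) *v x t) (at t)"
    using switched_solution_on[OF x] by metis
  have "wnorm (P \<alpha>) (x (?a + s)) \<le> exp (\<Gamma> * (?a + s - ?a)) * wnorm (P \<alpha>) (x ?a)"
  proof (rule wnorm_Gronwall[OF Q F(1) \<open>?a \<le> ?a + s\<close> F(2,3)])
    fix t assume t: "t \<in> {?a<..<?a + s} - F"
    let ?i = "switching_signal m \<alpha> \<tau> t"
    have "?i \<in> {1..m}"
      using switching_signal_in[OF \<alpha> \<open>0 < \<tau>\<close>, of "t - ?a" k] t s by simp
    then have "wopnorm (P \<alpha>) (A ?i) \<le> \<Gamma>"
      using wopnorm_le_growth[of ?i m P \<alpha> A] assms(7) by linarith
    then have "wnorm (P \<alpha>) (A ?i *v x t) \<le> \<Gamma> * wnorm (P \<alpha>) (x t)"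
      using wnorm_mult_le_wopnorm[OF Q, of "A ?i" "x t"] wnorm_nonneg[OF Q, of "x t"]
      by (meson mult_right_mono order_trans)
    then show "x t \<bullet> (P \<alpha> *v (A ?i *v x t)) \<le> \<Gamma> * (x t \<bullet> (P \<alpha> *v x t))"
      by (rule qform_le_of_wnorm_le[OF Q])
  qed
  then show ?thesis by (simp add: mult.commute)
qed

text \<open>The image of \<open>P\<close> is compact, so one constant \<open>K\<close> controls all
  operator norms, and weights between 0 and 1 only shrink the modes and their commutators. This
  gives majorants that do not depend on \<open>\<alpha>\<close>.\<close>

lemma growth_kappa_bdd_above:
  fixes A :: "nat \<Rightarrow> real^'n^'n"
  assumes \<A>: "\<A> \<subseteq> weight_simplex m" "compact \<A>" "continuous_on \<A> P"
    and Q: "\<And>\<alpha>. \<alpha> \<in> \<A> \<Longrightarrow> spd (P \<alpha>)" and "0 < \<tau>"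
  shows "bdd_above (growth m A P ` \<A>)" "bdd_above (kappa m A P \<eta> \<tau> ` \<A>)"
proof -
  have "\<And>R. R \<in> P ` \<A> \<Longrightarrow> spd R" using Q by blast
  then obtain K where "0 \<le> K"
    and K: "\<And>R M v. R \<in> P ` \<A> \<Longrightarrow> wnorm R (M *v v) \<le> K * norm M * wnorm R v"
    using wnorm_mult_uniform_bound[OF compact_continuous_image[OF \<A>(3,2)]] by blast
  have W: "wopnorm (P \<alpha>) M \<le> K * norm M" if "\<alpha> \<in> \<A>" for \<alpha> M
    using that by (intro wopnorm_le Q K imageI)
  define a where "a i = K * norm (A i)" for i
  define c where "c i k = K * norm (commutator (A k) (A i))" for i k
  have "0 \<le> a i" "0 \<le> c i k" for i k by (simp_all add: a_def c_def \<open>0 \<le> K\<close>)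
  have wt: "0 \<le> \<alpha> i" "\<alpha> i \<le> 1" if "\<alpha> \<in> \<A>" for \<alpha> i
    using that \<A>(1) weight_nonneg weight_le_1 by blast+
  have mode: "mode_norm A P \<alpha> i \<le> a i" if "\<alpha> \<in> \<A>" for \<alpha> i
  proof -
    have "norm (scaled_mode A \<alpha> i) \<le> norm (A i)"
      using wt[OF that, of i] by (simp add: scaled_mode_def mult_left_le_one_le)
    then show ?thesis
      using W[OF that, of "scaled_mode A \<alpha> i"] mult_left_mono[OF _ \<open>0 \<le> K\<close>] order_trans
      unfolding mode_norm_def a_def by blast
  qed
  have comm: "comm_norm A P \<alpha> i k \<le> c i k" if "\<alpha> \<in> \<A>" for \<alpha> i k
  proof -
    have "\<alpha> k * \<alpha> i \<le> 1" "0 \<le> \<alpha> k * \<alpha> i"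
      using wt[OF that] by (auto intro: mult_le_one)
    then have "norm (commutator (scaled_mode A \<alpha> k) (scaled_mode A \<alpha> i)) \<le> norm (commutator (A k) (A i))"
      by (simp add: scaled_mode_def commutator_scaleR mult_left_le_one_le)
    then show ?thesis
      using W[OF that, of "commutator (scaled_mode A \<alpha> k) (scaled_mode A \<alpha> i)"]
        mult_left_mono[OF _ \<open>0 \<le> K\<close>] order_trans
      unfolding comm_norm_def c_def by blast
  qed
  show "bdd_above (growth m A P ` \<A>)"
  proof (rule bdd_aboveI2)
    fix \<alpha> assume "\<alpha> \<in> \<A>"
    \<comment> \<open>\<open>Max\<close> needs a nonempty set; weights that sum to 1 exclude
      \<open>m = 0\<close>.\<close>
    have "0 < m"
      using \<A>(1) \<open>\<alpha> \<in> \<A>\<close> weight_dim_pos by blast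
    then have "growth m A P \<alpha> \<in> (\<lambda>i. wopnorm (P \<alpha>) (A i)) ` {1..m}"
      unfolding growth_def by (intro Max_in) auto
    then obtain i where "i \<in> {1..m}" "growth m A P \<alpha> = wopnorm (P \<alpha>) (A i)" by auto
    then have "growth m A P \<alpha> \<le> a i" using W[OF \<open>\<alpha> \<in> \<A>\<close>] by (simp add: a_def)
    also have "a i \<le> (\<Sum>i=1..m. a i)"
      using \<open>i \<in> {1..m}\<close> \<open>\<And>i. 0 \<le> a i\<close> by (intro member_le_sum) auto
    finally show "growth m A P \<alpha> \<le> (\<Sum>i=1..m. a i)" .
  qed
  show "bdd_above (kappa m A P \<eta> \<tau> ` \<A>)"
  proof (rule bdd_aboveI2)
    fix \<alpha> assume "\<alpha> \<in> \<A>"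
    have "0 \<le> g (\<tau> * a k)" for k
      using g_ge_half[of "\<tau> * a k"] \<open>0 < \<tau>\<close> \<open>\<And>i. 0 \<le> a i\<close> by simp
    moreover have "0 \<le> g (\<tau> * mode_norm A P \<alpha> k)" for k
      using g_ge_half[of "\<tau> * mode_norm A P \<alpha> k"] \<open>0 < \<tau>\<close>
      by (simp add: mode_norm_def wopnorm_nonneg[OF Q[OF \<open>\<alpha> \<in> \<A>\<close>]])
    \<comment> \<open>\<open>kappa\<close> increases with every mode norm and commutator norm,
      through the exponential, through \<open>g\<close> and through the inner sums.\<close>
    ultimately show "kappa m A P \<eta> \<tau> \<alpha> \<le> exp (- \<eta> * \<tau>) + \<tau>\<^sup>2 * exp (\<tau> * (\<Sum>i=1..m. a i)) *
        (\<Sum>k=2..m. g (\<tau> * a k) * (\<Sum>i=1..k-1. c i k))"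
      unfolding kappa_def total_norm_def using \<open>0 < \<tau>\<close> \<open>\<alpha> \<in> \<A>\<close>
      by (intro add_mono order_refl mult_mono mult_left_mono sum_mono g_mono mode comm
          sum_nonneg mult_nonneg_nonneg) 
        (auto simp: comm_norm_def wopnorm_nonneg[OF Q[OF \<open>\<alpha> \<in> \<A>\<close>]]
          intro!: mult_left_mono sum_mono mode)
  qed
qed

section \<open>Uniform exponential stability\<close>

theorem theorem8:
  fixes m :: nat
    and A :: "nat \<Rightarrow> real^'n^'n"
    and \<A> :: "(nat \<Rightarrow> real) set"
    and P :: "(nat \<Rightarrow> real) \<Rightarrow> real^'n^'n"
    and \<eta> \<tau> :: real
  assumes "\<A> \<subseteq> weight_simplex m"
    and "compact \<A>"
    and "continuous_on \<A> P"
    and "\<And>\<alpha>. \<alpha> \<in> \<A> \<Longrightarrow> spd (P \<alpha>)"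
    and "\<eta> > 0"
    and "\<And>\<alpha>. \<alpha> \<in> \<A> \<Longrightarrow>
           loewner_le
             (transpose (mean_matrix m A \<alpha>) ** P \<alpha> + P \<alpha> ** mean_matrix m A \<alpha>)
             ((- 2 * \<eta>) *\<^sub>R P \<alpha>)"
    and "\<tau> > 0"
    and "kappa_sup m A P \<A> \<eta> \<tau> < 1"
  shows "uniformly_exp_stable m A P \<A> \<tau> \<and>
    bdd_above (growth m A P ` \<A>) \<and>
    (\<forall>\<alpha>\<in>\<A>. \<forall>x. switched_solution m A \<alpha> \<tau> x \<longrightarrow>
       (\<forall>k::nat. wnorm (P \<alpha>) (x (real k * \<tau>)) \<le> kappa_sup m A P \<A> \<eta> \<tau> ^ k * wnorm (P \<alpha>) (x 0)) \<and>
       (\<forall>k::nat. \<forall>s\<in>{0..<\<tau>}.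
          wnorm (P \<alpha>) (x (real k * \<tau> + s))
            \<le> exp (s * growth_sup m A P \<A>) * kappa_sup m A P \<A> \<eta> \<tau> ^ k * wnorm (P \<alpha>) (x 0)))"
proof -
  define \<kappa> where "\<kappa> = kappa_sup m A P \<A> \<eta> \<tau>"
  define \<Gamma> where "\<Gamma> = growth_sup m A P \<A>"
  have bdd: "bdd_above (growth m A P ` \<A>)" "bdd_above (kappa m A P \<eta> \<tau> ` \<A>)"
    by (auto intro!: growth_kappa_bdd_above[OF assms(1-3)] assms(4) \<open>\<tau> > 0\<close>)
  have \<kappa>: "kappa m A P \<eta> \<tau> \<alpha> \<le> \<kappa>" if "\<alpha> \<in> \<A>" for \<alpha>
    unfolding \<kappa>_def kappa_sup_def using that by (intro cSUP_upper bdd)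
  have \<Gamma>: "growth m A P \<alpha> \<le> \<Gamma>" if "\<alpha> \<in> \<A>" for \<alpha>
    unfolding \<Gamma>_def growth_sup_def using that by (intro cSUP_upper bdd)
  \<comment> \<open>The supremum over an empty family carries no sign, so this and the next fact are
    stated given a member of \<open>\<A>\<close>.\<close>
  have \<kappa>_pos: "0 < \<kappa>" if "\<alpha> \<in> \<A>" for \<alpha>
    using kappa_ge[of P \<alpha> \<tau> \<eta> m A, OF assms(4)[OF that] \<open>\<tau> > 0\<close>] \<kappa>[OF that] exp_gt_zero[of "- \<eta> * \<tau>"]
    by linarith
  have \<Gamma>_nonneg: "0 \<le> \<Gamma>" if "\<alpha> \<in> \<A>" for \<alpha>
  proof -
    have "0 < m" using assms(1) that weight_dim_pos by blast
    then have "wopnorm (P \<alpha>) (A 1) \<le> \<Gamma>"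
      using wopnorm_le_growth[of 1 m P \<alpha> A] \<Gamma>[OF that] by simp
    then show ?thesis using wopnorm_nonneg[OF assms(4)[OF that], of "A 1"] by linarith
  qed
  have sampled: "wnorm (P \<alpha>) (x (real k * \<tau>)) \<le> \<kappa> ^ k * wnorm (P \<alpha>) (x 0)"
    if \<alpha>: "\<alpha> \<in> \<A>" and x: "switched_solution m A \<alpha> \<tau> x" for \<alpha> x k
  proof (induction k)
    case (Suc k)
    have "wnorm (P \<alpha>) (x (real (Suc k) * \<tau>))
        \<le> kappa m A P \<eta> \<tau> \<alpha> * wnorm (P \<alpha>) (x (real k * \<tau>))"
      using assms(1) \<alpha> by (intro wnorm_period_le \<open>\<tau> > 0\<close> x assms) auto
    also have "\<dots> \<le> \<kappa> * (\<kappa> ^ k * wnorm (P \<alpha>) (x 0))"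
      using \<alpha> Suc \<kappa>_pos[OF \<alpha>] assms(4)[OF \<alpha>] by (intro mult_mono \<kappa>) auto
    finally show ?case by simp
  qed simp
  have intersample: "wnorm (P \<alpha>) (x (real k * \<tau> + s)) \<le> exp (s * \<Gamma>) * \<kappa> ^ k * wnorm (P \<alpha>) (x 0)"
    if \<alpha>: "\<alpha> \<in> \<A>" and x: "switched_solution m A \<alpha> \<tau> x" and s: "s \<in> {0..<\<tau>}" for \<alpha> x k s
  proof -
    have "wnorm (P \<alpha>) (x (real k * \<tau> + s)) \<le> exp (s * \<Gamma>) * wnorm (P \<alpha>) (x (real k * \<tau>))"
      using assms(1) \<alpha> s by (intro wnorm_intersample_le[OF _ \<open>\<tau> > 0\<close> x] assms(4) \<Gamma>) auto
    also have "\<dots> \<le> exp (s * \<Gamma>) * (\<kappa> ^ k * wnorm (P \<alpha>) (x 0))"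
      by (intro mult_left_mono sampled \<alpha> x) simp
    finally show ?thesis by (simp add: mult.assoc)
  qed
  have stable: "uniformly_exp_stable m A P \<A> \<tau>"
  proof (cases "\<A> = {}")
    case True
    then show ?thesis unfolding uniformly_exp_stable_def
      by (intro exI[of _ 1] conjI) auto
  next
    case False
    then have "0 < \<kappa>" "0 \<le> \<Gamma>" using \<kappa>_pos \<Gamma>_nonneg by blast+
    have "\<kappa> < 1" using assms(8) by (simp add: \<kappa>_def)
    \<comment> \<open>Chosen so that decay at rate \<open>r\<close> over one period is exactly
      \<open>\<kappa>\<close>.\<close>
    define r where "r = - ln \<kappa> / \<tau>"
    \<comment> \<open>The exponential covers growth inside a period; dividing by
      \<open>\<kappa>\<close> pays for the last, incomplete period, which lies in the elapsed time
      \<open>t\<close> but contributes no power of \<open>\<kappa>\<close>.\<close>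
    define C where "C = exp (\<tau> * \<Gamma>) / \<kappa>"
    have "0 < r" using \<open>0 < \<kappa>\<close> \<open>\<kappa> < 1\<close> \<open>\<tau> > 0\<close> by (simp add: r_def divide_less_0_iff)
    have "1 \<le> C"
    proof -
      have "1 \<le> exp (\<tau> * \<Gamma>)" using \<open>\<tau> > 0\<close> \<open>0 \<le> \<Gamma>\<close> by simp
      then have "\<kappa> \<le> exp (\<tau> * \<Gamma>)" using \<open>\<kappa> < 1\<close> by linarith
      then show ?thesis using \<open>0 < \<kappa>\<close> by (simp add: C_def)
    qed
    have "wnorm (P \<alpha>) (x t) \<le> C * exp (- r * t) * wnorm (P \<alpha>) (x 0)"
      if \<alpha>: "\<alpha> \<in> \<A>" and x: "switched_solution m A \<alpha> \<tau> x" and "0 \<le> t" for \<alpha> x t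
    proof -
      define k where "k = nat \<lfloor>t / \<tau>\<rfloor>"
      define s where "s = t - real k * \<tau>"
      have k: "real k = of_int \<lfloor>t / \<tau>\<rfloor>"
        using \<open>0 \<le> t\<close> \<open>\<tau> > 0\<close> by (simp add: k_def)
      have "real k \<le> t / \<tau>" "t / \<tau> < real k + 1" unfolding k by linarith+
      then have s: "s \<in> {0..<\<tau>}" and "t \<le> (real k + 1) * \<tau>"
        using \<open>\<tau> > 0\<close> by (simp_all add: s_def field_simps)
      have "\<kappa> ^ k = exp (- r * (real k * \<tau>))"
        using \<open>0 < \<kappa>\<close> \<open>\<tau> > 0\<close> by (simp add: r_def exp_of_nat_mult mult.commute)
      also have "\<dots> \<le> exp (- r * t + r * \<tau>)"
        using mult_left_mono[OF \<open>t \<le> (real k + 1) * \<tau>\<close>, of r] \<open>0 < r\<close> by (simp add: algebra_simps)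
      also have "r * \<tau> = - ln \<kappa>"
        using \<open>\<tau> > 0\<close> by (simp add: r_def)
      also have "exp (- r * t + - ln \<kappa>) = exp (- r * t) / \<kappa>"
        using \<open>0 < \<kappa>\<close> by (simp add: exp_diff)
      finally have "\<kappa> ^ k \<le> exp (- r * t) / \<kappa>" .
      moreover have "exp (s * \<Gamma>) \<le> exp (\<tau> * \<Gamma>)"
        using s \<open>0 \<le> \<Gamma>\<close> by (simp add: mult_right_mono)
      ultimately have "exp (s * \<Gamma>) * \<kappa> ^ k \<le> exp (\<tau> * \<Gamma>) * (exp (- r * t) / \<kappa>)"
        using \<open>0 < \<kappa>\<close> by (intro mult_mono) auto
      then have "exp (s * \<Gamma>) * \<kappa> ^ k * wnorm (P \<alpha>) (x 0) \<le> C * exp (- r * t) * wnorm (P \<alpha>) (x 0)"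
        using assms(4)[OF \<alpha>] by (intro mult_right_mono) (simp_all add: C_def)
      moreover have "x t = x (real k * \<tau> + s)" by (simp add: s_def)
      ultimately show ?thesis using intersample[OF \<alpha> x s, of k] by simp
    qed
    then show ?thesis
      unfolding uniformly_exp_stable_def using \<open>1 \<le> C\<close> \<open>0 < r\<close> by blast
  qed
  show ?thesis
    using stable bdd(1) sampled intersample unfolding \<kappa>_def \<Gamma>_def by blast
qed

end
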